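(* Let $\mathbb{K}$ be a field, $S=\mathbb{K}[x_1,\ldots,x_n]$ and let $\mathfrak{I}$ be a monomial ideal of $S$. Then every synor-resolution $(F_*,\delta_* )$ of $S/\mathfrak{I}$ is a minimal free resolution of $S/\mathfrak{I}$.
   Context: Chains. For a finite poset $\mathcal{P}$ and $k \ge -1$, $\widetilde{C}_k(\mathcal{P})$ is the $\mathbb{K}$-vector space with basis the order chains $(x_0 > \cdots > x_k)$ in $\mathcal{P}$ (for $k=-1$ the empty chain, so $\widetilde{C}_{-1}=\mathbb{K}$), with $\partial_k = \sum_{j=0}^k (-1)^j\partial_k^{(j)}$, where $\partial_k^{(j)}$ deletes $x_j$. Its homology is $\widetilde{H}_*(\mathcal{P})$. $\mathcal{P}_{<x}=\{y\in \mathcal{P}: y<x\}$; an order ideal is a subset closed under passing to smaller elements. Graded complexes. A $\mathcal{P}$-graded complex is a complex $(C_*,\partial_* )$ of $\mathbb{K}$-vector spaces (in degrees $\ge -1$) with $C_{-1}=\mathbb{K}$, $C_i = \bigoplus_{x\in\mathcal{P}} C_i^{(x)}$ for $i\ge 0$, and $\partial_i(C_i^{(x)}) \subseteq \bigoplus_{y \le x} C_{i-1}^{(y)}$ for $i\ge1$; it is strictly $\mathcal{P}$-graded if $\partial_i(C_i^{(x)}) \subseteq \bigoplus_{y<x} C_{i-1}^{(y)}$ for $i\ge 1$. $\widetilde{C}_*(\mathcal{P})$ is $\mathcal{P}$-graded, with $\widetilde{C}_i(\mathcal{P})^{(x)}$ spanned by the chains with largest element $x$. For an order ideal $\mathcal{J}$,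 $C_*^{\mathcal{J}}$ is the subcomplex with $C_i^{\mathcal{J}}=\bigoplus_{x\in\mathcal{J}}C_i^{(x)}$ for $i \ge 0$ and $C_{-1}^{\mathcal{J}}=\mathbb{K}$. A $\mathcal{P}$-graded chain map $\phi: C_*\to D_*$ is a chain map with $\phi(C_i^{(x)})\subseteq D_i^{(x)}$ for $i\ge 0$ and $\phi(C_{-1})=D_{-1}$. Synor complex. A synor complex for $\mathcal{P}$ is a strictly $\mathcal{P}$-graded complex $(\mathcal{S}_*(\mathcal{P}),\partial_* )$ together with an injective $\mathcal{P}$-graded chain map $\phi:\mathcal{S}_*(\mathcal{P})\to\widetilde{C}_*(\mathcal{P})$ such that (S1) $\dim_{\mathbb{K}}\mathcal{S}_i(\mathcal{P})^{(x)}=\dim_{\mathbb{K}}\widetilde{H}_{i-1}(\mathcal{P}_{<x})$ for all $x \in \mathcal{P}$, $i\ge0$; (S2) for every order ideal $\mathcal{J}$ of $\mathcal{P}$ the restriction of $\phi$ to $\mathcal{S}_*(\mathcal{P})^{\mathcal{J}}$ induces an isomorphism $H_*(\mathcal{S}(\mathcal{P})^{\mathcal{J}})\cong\widetilde{H}_*(\mathcal{J})$. Synor-resolution. Let $\mathrm{lcm}(\mathfrak{I})$ be the LCM-lattice: the set of all least common multiples of subsets of the minimal monomial generating set of $\mathfrak{I}$ (with the lcm of $\emptyset$ equal to $1$), ordered by divisibility; let $\mathcal{Q}=\mathrm{lcm}(\mathfrak{I})\setminus\{1\}$ and let $(\mathcal{S}_*(\mathcal{Q}),\partial_* )$ be a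 synor complex for $\mathcal{Q}$. Let $S(-m)$ be the multigraded free $S$-module of rank 1 in which a monomial $m'$ has multidegree $mm'$. Set $F_0=\mathcal{S}_{-1}(\mathcal{Q})\otimes_{\mathbb{K}} S(-1)\cong S$ (here $\mathcal{S}_{-1}(\mathcal{Q})=\mathbb{K}$ is regarded as concentrated in the multidegree of the monomial $1$), and for $i\ge1$ set $F_i=\bigoplus_{m\in\mathcal{Q}}\mathcal{S}_{i-1}(\mathcal{Q})^{(m)}\otimes_{\mathbb{K}} S(-m)$. For $\zeta\in\mathcal{S}_{i-1}(\mathcal{Q})^{(m)}$ with $i \ge 2$ write $\partial_{i-1}(\zeta)=\sum_{m'\in\mathcal{Q}_{<m}}\zeta_{m'}$ with $\zeta_{m'}\in\mathcal{S}_{i-2}(\mathcal{Q})^{(m')}$ and define the $S$-linear map $\delta_i:F_i\to F_{i-1}$ by $\delta_i(\zeta\otimes1)=\sum_{m'\in\mathcal{Q}_{<m}}\frac{m}{m'}\,\zeta_{m'}\otimes1$; for $i=1$ and $\zeta\in\mathcal{S}_0(\mathcal{Q})^{(m)}$ set $\delta_1(\zeta\otimes 1)=m\,(\partial_0(\zeta)\otimes1)$. Any $(F_*,\delta_* )$ obtained in this way is called a synor-resolution of $S/\mathfrak{I}$.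
   Formalization: The monomial ideal is assumed proper: for the unit ideal the LCM-lattice is {1}, so the synor-resolution is S in degree 0, which does not resolve S/I = 0. *)

theory Defs
  imports Complex_Main "HOL-Library.Poly_Mapping"
begin

section \<open>Complexes of modules and their homology\<close>

text \<open>
  All modules of a complex are submodules \<open>chn X i\<close> of one ambient module, given by a type
  together with the scalar multiplication \<open>smul X\<close>. The same record serves for complexes of
  \<open>K\<close>-vector spaces and of modules over the polynomial ring. \<open>cmp X i x\<close> is the component
  \<open>C_i^(x)\<close> of a grading; for \<open>P\<close>-graded complexes it is meaningful only for
  \<open>i \<ge> 0\<close> and \<open>x \<in> P\<close>.
\<close>

record ('r, 'v, 'x) gcplx =
  smul :: "'r \<Rightarrow> 'v \<Rightarrow> 'v"
  chn :: "int \<Rightarrow> 'v set"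
  bnd :: "int \<Rightarrow> 'v \<Rightarrow> 'v"
  cmp :: "int \<Rightarrow> 'x \<Rightarrow> 'v set"

definition linear_on ::
  "('r \<Rightarrow> 'v \<Rightarrow> 'v) \<Rightarrow> ('r \<Rightarrow> 'w \<Rightarrow> 'w) \<Rightarrow> 'v::ab_group_add set \<Rightarrow> ('v \<Rightarrow> 'w::ab_group_add) \<Rightarrow> bool"
  where "linear_on s t A f \<longleftrightarrow>
    (\<forall>v\<in>A. \<forall>w\<in>A. f (v + w) = f v + f w) \<and> (\<forall>c. \<forall>v\<in>A. f (s c v) = t c (f v))"

definition is_complex :: "('r::comm_ring_1, 'v::ab_group_add, 'x) gcplx \<Rightarrow> bool"
  where "is_complex X \<longleftrightarrow>
    module (smul X) \<and>
    (\<forall>i. module.subspace (smul X) (chn X i)) \<and>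
    (\<forall>i. linear_on (smul X) (smul X) (chn X i) (bnd X i)) \<and>
    (\<forall>i. bnd X i ` chn X i \<subseteq> chn X (i - 1)) \<and>
    (\<forall>i. \<forall>v\<in>chn X i. bnd X (i - 1) (bnd X i v) = 0)"

definition cycles :: "('r, 'v::ab_group_add, 'x) gcplx \<Rightarrow> int \<Rightarrow> 'v set"
  where "cycles X k = {v \<in> chn X k. bnd X k v = 0}"

definition boundaries :: "('r, 'v::ab_group_add, 'x) gcplx \<Rightarrow> int \<Rightarrow> 'v set"
  where "boundaries X k = bnd X (k + 1) ` chn X (k + 1)"

definition coset :: "'v::ab_group_add set \<Rightarrow> 'v \<Rightarrow> 'v set"
  where "coset B z = (+) z ` B"

definition homology :: "('r, 'v::ab_group_add, 'x) gcplx \<Rightarrow> int \<Rightarrow> 'v set set"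
  where "homology X k = coset (boundaries X k) ` cycles X k"

text \<open>\<open>[z] \<mapsto> [f z]\<close>: a coset \<open>A\<close> is sent to \<open>f(A)\<close> plus the boundaries of the target.\<close>

definition homology_map ::
  "('r, 'w::ab_group_add, 'y) gcplx \<Rightarrow> ('v \<Rightarrow> 'w) \<Rightarrow> int \<Rightarrow> 'v set \<Rightarrow> 'w set"
  where "homology_map Y f k A = {f a + b | a b. a \<in> A \<and> b \<in> boundaries Y k}"

text \<open>
  The classes in \<open>Z / B\<close> of the elements of \<open>E \<subseteq> Z\<close> are pairwise distinct and form a basis of the
  quotient space. As for the library's \<open>vector_space.dim\<close>, an infinite-dimensional quotient gets
  dimension \<open>0\<close>; this does not occur for the order complex of a finite poset.
\<close>

definition quotient_basis ::
  "('k::field \<Rightarrow> 'v::ab_group_add \<Rightarrow> 'v) \<Rightarrow> 'v set \<Rightarrow> 'v set \<Rightarrow> 'v set \<Rightarrow> bool"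
  where "quotient_basis s Z B E \<longleftrightarrow>
    E \<subseteq> Z \<and>
    (\<forall>T u. finite T \<and> T \<subseteq> E \<and> (\<Sum>v\<in>T. s (u v) v) \<in> B \<longrightarrow> (\<forall>v\<in>T. u v = 0)) \<and>
    (\<forall>z\<in>Z. \<exists>w\<in>module.span s E. z - w \<in> B)"

definition quotient_dim ::
  "('k::field \<Rightarrow> 'v::ab_group_add \<Rightarrow> 'v) \<Rightarrow> 'v set \<Rightarrow> 'v set \<Rightarrow> nat"
  where "quotient_dim s Z B = card (SOME E. quotient_basis s Z B E)"

definition homology_dim :: "('k::field, 'v::ab_group_add, 'x) gcplx \<Rightarrow> int \<Rightarrow> nat"
  where "homology_dim X k = quotient_dim (smul X) (cycles X k) (boundaries X k)"

text \<open>The sum of the \<open>A x\<close>, \<open>x \<in> J\<close>, inside the ambient module, and directness of that sum.\<close>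

definition family_sum :: "('x \<Rightarrow> 'v::ab_group_add set) \<Rightarrow> 'x set \<Rightarrow> 'v set"
  where "family_sum A J = {(\<Sum>x\<in>T. f x) | T f. finite T \<and> T \<subseteq> J \<and> (\<forall>x\<in>T. f x \<in> A x)}"

definition is_direct_sum :: "'v::ab_group_add set \<Rightarrow> ('x \<Rightarrow> 'v set) \<Rightarrow> 'x set \<Rightarrow> bool"
  where "is_direct_sum V A J \<longleftrightarrow>
    V = family_sum A J \<and>
    (\<forall>T f. finite T \<and> T \<subseteq> J \<and> (\<forall>x\<in>T. f x \<in> A x) \<and> (\<Sum>x\<in>T. f x) = 0 \<longrightarrow> (\<forall>x\<in>T. f x = 0))"


section \<open>Finite posets and order complexes\<close>

definition finite_poset :: "'p set \<Rightarrow> ('p \<Rightarrow> 'p \<Rightarrow> bool) \<Rightarrow> bool"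
  where "finite_poset P le \<longleftrightarrow>
    finite P \<and>
    (\<forall>x\<in>P. le x x) \<and>
    (\<forall>x\<in>P. \<forall>y\<in>P. le x y \<longrightarrow> le y x \<longrightarrow> x = y) \<and>
    (\<forall>x\<in>P. \<forall>y\<in>P. \<forall>z\<in>P. le x y \<longrightarrow> le y z \<longrightarrow> le x z)"

definition below :: "'p set \<Rightarrow> ('p \<Rightarrow> 'p \<Rightarrow> bool) \<Rightarrow> 'p \<Rightarrow> 'p set"
  where "below P le x = {y \<in> P. le y x \<and> y \<noteq> x}"

definition order_ideal :: "'p set \<Rightarrow> ('p \<Rightarrow> 'p \<Rightarrow> bool) \<Rightarrow> 'p set \<Rightarrow> bool"
  where "order_ideal P le J \<longleftrightarrow> J \<subseteq> P \<and> (\<forall>x\<in>J. \<forall>y\<in>P. le y x \<longrightarrow> y \<in> J)"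

text \<open>The chain \<open>x_0 > \<dots> > x_k\<close> is the list \<open>[x_0, \<dots>, x_k]\<close>.\<close>

definition chains :: "'p set \<Rightarrow> ('p \<Rightarrow> 'p \<Rightarrow> bool) \<Rightarrow> int \<Rightarrow> 'p list set"
  where "chains P le k =
    {xs. int (length xs) = k + 1 \<and> set xs \<subseteq> P \<and> sorted_wrt (\<lambda>x y. le y x \<and> y \<noteq> x) xs}"

definition delete_at :: "nat \<Rightarrow> 'p list \<Rightarrow> 'p list"
  where "delete_at j xs = take j xs @ drop (Suc j) xs"

definition chain_bnd :: "('p list \<Rightarrow>\<^sub>0 'k::field) \<Rightarrow> ('p list \<Rightarrow>\<^sub>0 'k)"
  where "chain_bnd f =
    (\<Sum>xs\<in>Poly_Mapping.keys f. \<Sum>j<length xs.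
      Poly_Mapping.single (delete_at j xs) ((-1) ^ j * Poly_Mapping.lookup f xs))"

definition order_complex ::
  "'p set \<Rightarrow> ('p \<Rightarrow> 'p \<Rightarrow> bool) \<Rightarrow> ('k::field, 'p list \<Rightarrow>\<^sub>0 'k, 'p) gcplx"
  where "order_complex P le =
    \<lparr> smul = (\<lambda>c. Poly_Mapping.map ((*) c)),
      chn = (\<lambda>k. {f. Poly_Mapping.keys f \<subseteq> chains P le k}),
      bnd = (\<lambda>_. chain_bnd),
      cmp = (\<lambda>k x. {f. Poly_Mapping.keys f \<subseteq> {xs \<in> chains P le k. xs \<noteq> [] \<and> hd xs = x}}) \<rparr>"


section \<open>Graded complexes and synor complexes\<close>

text \<open>
  \<open>C_(-1) = K\<close> is rendered as: \<open>C_(-1)\<close> is one-dimensional. No identification with \<open>K\<close> is fixed,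
  as graded chain maps are only required to map \<open>C_(-1)\<close> onto \<open>D_(-1)\<close>.
\<close>

definition graded_complex ::
  "'p set \<Rightarrow> ('p \<Rightarrow> 'p \<Rightarrow> bool) \<Rightarrow> ('k::field, 'v::ab_group_add, 'p) gcplx \<Rightarrow> bool"
  where "graded_complex P le X \<longleftrightarrow>
    is_complex X \<and>
    (\<forall>i < -1. chn X i = {0}) \<and>
    vector_space.dim (smul X) (chn X (-1)) = 1 \<and>
    (\<forall>i\<ge>0. (\<forall>x\<in>P. module.subspace (smul X) (cmp X i x)) \<and>
      is_direct_sum (chn X i) (cmp X i) P) \<and>
    (\<forall>i\<ge>1. \<forall>x\<in>P. bnd X i ` cmp X i x \<subseteq> family_sum (cmp X (i - 1)) {y \<in> P. le y x})"

definition strictly_graded_complex ::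
  "'p set \<Rightarrow> ('p \<Rightarrow> 'p \<Rightarrow> bool) \<Rightarrow> ('k::field, 'v::ab_group_add, 'p) gcplx \<Rightarrow> bool"
  where "strictly_graded_complex P le X \<longleftrightarrow>
    graded_complex P le X \<and>
    (\<forall>i\<ge>1. \<forall>x\<in>P. bnd X i ` cmp X i x \<subseteq> family_sum (cmp X (i - 1)) (below P le x))"

definition ideal_subcomplex ::
  "('k, 'v::ab_group_add, 'p) gcplx \<Rightarrow> 'p set \<Rightarrow> ('k, 'v, 'p) gcplx"
  where "ideal_subcomplex X J =
    X\<lparr>chn := (\<lambda>i. if 0 \<le> i then family_sum (cmp X i) J else chn X i)\<rparr>"

definition graded_chain_map ::
  "'p set \<Rightarrow> ('k, 'v::ab_group_add, 'p) gcplx \<Rightarrow> ('k, 'w::ab_group_add, 'p) gcplx \<Rightarrow>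
    (int \<Rightarrow> 'v \<Rightarrow> 'w) \<Rightarrow> bool"
  where "graded_chain_map P X Y \<phi> \<longleftrightarrow>
    (\<forall>i. linear_on (smul X) (smul Y) (chn X i) (\<phi> i) \<and> \<phi> i ` chn X i \<subseteq> chn Y i) \<and>
    (\<forall>i. \<forall>v\<in>chn X i. \<phi> (i - 1) (bnd X i v) = bnd Y i (\<phi> i v)) \<and>
    (\<forall>i\<ge>0. \<forall>x\<in>P. \<phi> i ` cmp X i x \<subseteq> cmp Y i x) \<and>
    \<phi> (-1) ` chn X (-1) = chn Y (-1)"

text \<open>
  In the first dimension condition both sides are finite, since the injective \<open>\<phi>\<close> embeds
  everything into chain spaces of a finite poset.
\<close>

definition synor_complex ::
  "'p set \<Rightarrow> ('p \<Rightarrow> 'p \<Rightarrow> bool) \<Rightarrow> ('k::field, 'v::ab_group_add, 'p) gcplx \<Rightarrow>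
    (int \<Rightarrow> 'v \<Rightarrow> ('p list \<Rightarrow>\<^sub>0 'k)) \<Rightarrow> bool"
  where "synor_complex P le X \<phi> \<longleftrightarrow>
    finite_poset P le \<and>
    strictly_graded_complex P le X \<and>
    graded_chain_map P X (order_complex P le) \<phi> \<and>
    (\<forall>i. inj_on (\<phi> i) (chn X i)) \<and>
    (\<forall>x\<in>P. \<forall>i\<ge>0. vector_space.dim (smul X) (cmp X i x) =
      homology_dim (order_complex (below P le x) le :: ('k, 'p list \<Rightarrow>\<^sub>0 'k, 'p) gcplx) (i - 1)) \<and>
    (\<forall>J. order_ideal P le J \<longrightarrow>
      (\<forall>k. bij_betw (homology_map (order_complex J le :: ('k, 'p list \<Rightarrow>\<^sub>0 'k, 'p) gcplx) (\<phi> k) k)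
        (homology (ideal_subcomplex X J) k)
        (homology (order_complex J le :: ('k, 'p list \<Rightarrow>\<^sub>0 'k, 'p) gcplx) k)))"


section \<open>Monomial ideals and the LCM-lattice\<close>

text \<open>
  Monomials are exponent vectors, written additively: the monomial \<open>1\<close> is \<open>0\<close>, the product of
  \<open>m\<close> and \<open>m'\<close> is \<open>m + m'\<close>, and \<open>m / m'\<close> (for \<open>m'\<close> dividing \<open>m\<close>) is \<open>m - m'\<close>. The order on
  monomials is divisibility, not the library's lexicographic order on \<open>\<Rightarrow>\<^sub>0\<close>.
\<close>

type_synonym 'n mono = "'n \<Rightarrow>\<^sub>0 nat"
type_synonym ('n, 'k) mpoly = "'n mono \<Rightarrow>\<^sub>0 'k"

definition mono_dvd :: "'n mono \<Rightarrow> 'n mono \<Rightarrow> bool"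
  where "mono_dvd a b \<longleftrightarrow> (\<exists>c. b = a + c)"

definition is_mono_lcm :: "'n mono set \<Rightarrow> 'n mono \<Rightarrow> bool"
  where "is_mono_lcm A l \<longleftrightarrow>
    (\<forall>a\<in>A. mono_dvd a l) \<and> (\<forall>c. (\<forall>a\<in>A. mono_dvd a c) \<longrightarrow> mono_dvd l c)"

definition mono_poly :: "'n mono \<Rightarrow> ('n, 'k::field) mpoly"
  where "mono_poly a = Poly_Mapping.single a 1"

definition ideal_gen :: "'s::comm_ring_1 set \<Rightarrow> 's set"
  where "ideal_gen A = module.span (*) A"

definition monomial_ideal :: "('n, 'k::field) mpoly set \<Rightarrow> bool"
  where "monomial_ideal I \<longleftrightarrow> (\<exists>G. I = ideal_gen (mono_poly ` G))"

definition min_mono_gens :: "('n, 'k::field) mpoly set \<Rightarrow> 'n mono set"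
  where "min_mono_gens I = (THE G. I = ideal_gen (mono_poly ` G) \<and>
    (\<forall>H. H \<subset> G \<longrightarrow> I \<noteq> ideal_gen (mono_poly ` H)))"

definition lcm_lattice :: "('n, 'k::field) mpoly set \<Rightarrow> 'n mono set"
  where "lcm_lattice I = {l. \<exists>A. A \<subseteq> min_mono_gens I \<and> is_mono_lcm A l}"

definition max_ideal :: "('n, 'k::field) mpoly set"
  where "max_ideal = ideal_gen {mono_poly (Poly_Mapping.single j 1) | j. True}"


section \<open>Minimal free resolutions\<close>

definition free_basis :: "('r::comm_ring_1 \<Rightarrow> 'v::ab_group_add \<Rightarrow> 'v) \<Rightarrow> 'v set \<Rightarrow> 'v set \<Rightarrow> bool"
  where "free_basis s M E \<longleftrightarrow> \<not> module.dependent s E \<and> module.span s E = M"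

text \<open>
  A complex of multigraded free modules of finite rank over the polynomial ring, with
  \<open>cmp R i u\<close> the part of \<open>F_i\<close> of multidegree \<open>u\<close> and with maps of multidegree \<open>0\<close>.
\<close>

definition multigraded_free_complex ::
  "(('n, 'k::field) mpoly, 'f::ab_group_add, 'n mono) gcplx \<Rightarrow> bool"
  where "multigraded_free_complex R \<longleftrightarrow>
    is_complex R \<and>
    (\<forall>i<0. chn R i = {0}) \<and>
    (\<forall>i u. module.subspace (\<lambda>c::'k. smul R (Poly_Mapping.single 0 c)) (cmp R i u)) \<and>
    (\<forall>i. is_direct_sum (chn R i) (cmp R i) UNIV) \<and>
    (\<forall>i u a c. smul R (Poly_Mapping.single a c) ` cmp R i u \<subseteq> cmp R i (u + a)) \<and>
    (\<forall>i u. bnd R i ` cmp R i u \<subseteq> cmp R (i - 1) u) \<and>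
    (\<forall>i. \<exists>E. finite E \<and> E \<subseteq> (\<Union>u. cmp R i u) \<and> free_basis (smul R) (chn R i) E)"

text \<open>
  \<open>\<epsilon>\<close> is a surjective homomorphism of multigraded modules from \<open>F_0\<close> to \<open>S / I\<close>, whose elements are
  the cosets of \<open>I\<close>.
\<close>

definition is_augmentation ::
  "('n, 'k::field) mpoly set \<Rightarrow> (('n, 'k) mpoly, 'f::ab_group_add, 'n mono) gcplx \<Rightarrow>
    ('f \<Rightarrow> ('n, 'k) mpoly set) \<Rightarrow> bool"
  where "is_augmentation I R \<epsilon> \<longleftrightarrow>
    \<epsilon> ` chn R 0 = {coset I f | f. True} \<and>
    (\<forall>g\<in>chn R 0. \<forall>h\<in>chn R 0. \<forall>p\<in>\<epsilon> g. \<forall>q\<in>\<epsilon> h. p + q \<in> \<epsilon> (g + h)) \<and>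
    (\<forall>r. \<forall>g\<in>chn R 0. \<forall>p\<in>\<epsilon> g. r * p \<in> \<epsilon> (smul R r g)) \<and>
    (\<forall>u. \<forall>g\<in>cmp R 0 u. \<exists>c. Poly_Mapping.single u c \<in> \<epsilon> g)"

definition free_resolution ::
  "('n, 'k::field) mpoly set \<Rightarrow> (('n, 'k) mpoly, 'f::ab_group_add, 'n mono) gcplx \<Rightarrow> bool"
  where "free_resolution I R \<longleftrightarrow>
    multigraded_free_complex R \<and>
    (\<forall>i\<ge>1. cycles R i = boundaries R i) \<and>
    (\<exists>\<epsilon>. is_augmentation I R \<epsilon> \<and> {g \<in> chn R 0. \<epsilon> g = I} = boundaries R 0)"

definition minimal_free_resolution ::
  "('n, 'k::field) mpoly set \<Rightarrow> (('n, 'k) mpoly, 'f::ab_group_add, 'n mono) gcplx \<Rightarrow> bool"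
  where "minimal_free_resolution I R \<longleftrightarrow>
    free_resolution I R \<and>
    (\<forall>i\<ge>1. bnd R i ` chn R i \<subseteq>
      module.span (smul R) {smul R p g | p g. p \<in> max_ideal \<and> g \<in> chn R (i - 1)})"


section \<open>Synor-resolutions\<close>

text \<open>
  For a \<open>K\<close>-vector space \<open>V\<close>, the tensor product \<open>V \<otimes> S(-m)\<close> is the space of polynomials with
  coefficients in \<open>V\<close>. An element of a direct sum of such modules is a finitely supported function
  \<open>h\<close> on pairs: \<open>single (m, a) \<zeta>\<close> is \<open>\<zeta> \<otimes> x^a\<close> in the summand with index \<open>m\<close>, an element of
  multidegree \<open>m + a\<close>. The argument \<open>s\<close> below is the scalar multiplication of \<open>V\<close>.
\<close>

definition poly_smul ::
  "('k \<Rightarrow> 'v \<Rightarrow> 'v) \<Rightarrow> ('n, 'k::field) mpoly \<Rightarrow> ('n mono \<times> 'n mono \<Rightarrow>\<^sub>0 'v::ab_group_add) \<Rightarrow>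
    ('n mono \<times> 'n mono \<Rightarrow>\<^sub>0 'v)"
  where "poly_smul s p h =
    (\<Sum>b\<in>Poly_Mapping.keys p. \<Sum>(m, a)\<in>Poly_Mapping.keys h.
      Poly_Mapping.single (m, b + a) (s (Poly_Mapping.lookup p b) (Poly_Mapping.lookup h (m, a))))"

text \<open>The vector space tensored with \<open>S(-m)\<close> in \<open>F_i\<close>.\<close>

definition synor_coeffs ::
  "'n mono set \<Rightarrow> ('k, 'v::ab_group_add, 'n mono) gcplx \<Rightarrow> int \<Rightarrow> 'n mono \<Rightarrow> 'v set"
  where "synor_coeffs Q X i m =
    (if i = 0 \<and> m = 0 then chn X (-1) else if i \<ge> 1 \<and> m \<in> Q then cmp X (i - 1) m else {0})"

definition synor_resolution_of ::
  "'n mono set \<Rightarrow> ('k::field, 'v::ab_group_add, 'n mono) gcplx \<Rightarrow>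
    (('n, 'k) mpoly, 'n mono \<times> 'n mono \<Rightarrow>\<^sub>0 'v, 'n mono) gcplx \<Rightarrow> bool"
  where "synor_resolution_of Q X R \<longleftrightarrow>
    smul R = poly_smul (smul X) \<and>
    (\<forall>i. chn R i = {h. \<forall>m a. Poly_Mapping.lookup h (m, a) \<in> synor_coeffs Q X i m}) \<and>
    (\<forall>i u. cmp R i u = {h \<in> chn R i. \<forall>(m, a)\<in>Poly_Mapping.keys h. m + a = u}) \<and>
    (\<forall>i. linear_on (smul R) (smul R) (chn R i) (bnd R i) \<and>
      bnd R i ` chn R i \<subseteq> chn R (i - 1)) \<and>
    (\<forall>m\<in>Q. \<forall>\<zeta>\<in>cmp X 0 m.
      bnd R 1 (Poly_Mapping.single (m, 0) \<zeta>) =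
        smul R (mono_poly m) (Poly_Mapping.single (0, 0) (bnd X 0 \<zeta>))) \<and>
    (\<forall>i\<ge>2. \<forall>m\<in>Q. \<forall>\<zeta>\<in>cmp X (i - 1) m. \<forall>z.
      (\<forall>m'\<in>below Q mono_dvd m. z m' \<in> cmp X (i - 2) m') \<and>
      bnd X (i - 1) \<zeta> = (\<Sum>m'\<in>below Q mono_dvd m. z m') \<longrightarrow>
      bnd R i (Poly_Mapping.single (m, 0) \<zeta>) =
        (\<Sum>m'\<in>below Q mono_dvd m.
          smul R (mono_poly (m - m')) (Poly_Mapping.single (m', 0) (z m'))))"

definition synor_resolution ::
  "('n, 'k::field) mpoly set \<Rightarrow>
    (('n, 'k) mpoly, 'n mono \<times> 'n mono \<Rightarrow>\<^sub>0 'v::ab_group_add, 'n mono) gcplx \<Rightarrow> bool"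
  where "synor_resolution I R \<longleftrightarrow>
    (\<exists>X \<phi>. synor_complex (lcm_lattice I - {0}) mono_dvd X \<phi> \<and>
      synor_resolution_of (lcm_lattice I - {0}) X R)"

end

theory Submission
  imports Defs
begin

text \<open>
  Setting all variables to \<open>1\<close> identifies the part of \<open>F_*\<close> in multidegree \<open>u\<close> with the subcomplex
  \<open>S(Q)^J\<close> (shifted by one) for the order ideal \<open>J\<close> of all \<open>m \<in> Q\<close> dividing \<open>u\<close>. If the monomial \<open>u\<close>
  lies in the ideal, then \<open>J\<close> has a largest element, namely the lcm of the generators dividing \<open>u\<close>;
  its order complex is a cone, so by (S2) the strand of \<open>F_*\<close> in multidegree \<open>u\<close> is exact. Otherwise
  \<open>J\<close> is empty and the strand is just the field in degree \<open>0\<close>. Minimality is strictness of the grading: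
  every matrix entry of \<open>\<delta>\<close> is a scalar times a monomial \<open>m / m' \<noteq> 1\<close>.
\<close>

section \<open>Finitely supported functions\<close>

text \<open>A synor-resolution prescribes \<open>\<delta>\<close> only on the generators
  \<open>\<zeta> \<otimes> 1\<close>, and \<open>\<delta>\<delta> = 0\<close> is not part of its
  data. Both the complex property and exactness are therefore pulled back along the substitution,
  which forgets multidegrees and is injective only on one multidegree at a time: there the index m
  determines the exponent u/m, so no two terms share a component, and directness of the grading of
  the synor complex applies. Going back, a chain is made homogeneous by multiplying its component at
  m with u/m, which is possible exactly for m dividing u. Reduced chains matter. The cokernel of
  \<open>\<delta>_1\<close> is governed by the strands in degree -1, where the cone sends the empty
  chain to the chain consisting of the top element. Two facts have to be extracted from the abstract
  data. Finite rank is visible only through the embedding \<open>\<phi>\<close> into the chains of a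
  finite poset. The space in degree -1 is merely one-dimensional, so the identification of F_0 with
  S, and with it the augmentation, depends on a chosen nonzero vector.\<close>

lemma poly_mapping_sum_induct:
  fixes h :: "'a \<Rightarrow>\<^sub>0 'b::comm_monoid_add"
  assumes "P 0" and "\<And>f g. P f \<Longrightarrow> P g \<Longrightarrow> P (f + g)"
    and single: "\<And>k. k \<in> Poly_Mapping.keys h \<Longrightarrow> P (Poly_Mapping.single k (Poly_Mapping.lookup h k))"
  shows "P h"
proof -
  have sum: "P (\<Sum>k\<in>A. f k)" if "finite A" "\<And>k. k \<in> A \<Longrightarrow> P (f k)" for A and f :: "'a \<Rightarrow> 'a \<Rightarrow>\<^sub>0 'b"
    using that by (induction A rule: finite_induct) (auto intro: assms)
  have "h = (\<Sum>k\<in>Poly_Mapping.keys h. Poly_Mapping.single k (Poly_Mapping.lookup h k))"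
    by (rule poly_mapping_eqI)
      (auto simp: lookup_sum lookup_single when_def in_keys_iff if_distrib cong: if_cong)
  then show ?thesis
    using sum[of "Poly_Mapping.keys h" "\<lambda>k. Poly_Mapping.single k (Poly_Mapping.lookup h k)"] single
    by simp
qed

lemma poly_mapping_induct_single:
  fixes h :: "'a \<Rightarrow>\<^sub>0 'b::comm_monoid_add"
  assumes "\<And>k c. P (Poly_Mapping.single k c)" and "\<And>f g. P f \<Longrightarrow> P g \<Longrightarrow> P (f + g)"
  shows "P h"
  by (rule poly_mapping_sum_induct) (use assms(1)[of _ 0] in \<open>auto intro: assms\<close>)

text \<open>The universal property of a direct sum: a family of additive maps, one for each key,
  extends to an additive map. Boundary, cone operator, scalar multiplication and substitution all
  arise in this way, so each is additive and determined by its values on single terms.\<close>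

definition keys_sum :: "('a \<Rightarrow> 'b::ab_group_add \<Rightarrow> 'c::ab_group_add) \<Rightarrow> ('a \<Rightarrow>\<^sub>0 'b) \<Rightarrow> 'c"
  where "keys_sum f h = (\<Sum>k\<in>Poly_Mapping.keys h. f k (Poly_Mapping.lookup h k))"

lemma additive_keys_sum:
  assumes "\<And>k. additive (f k)"
  shows "additive (keys_sum f)"
proof
  show "keys_sum f (g + h) = keys_sum f g + keys_sum f h" for g h
    unfolding keys_sum_def
    by (rule setsum_keys_plus_distrib) (auto simp: additive.zero additive.add assms)
qed

lemma keys_sum_single:
  assumes "additive (f k)"
  shows "keys_sum f (Poly_Mapping.single k v) = f k v"
  using assms by (auto simp: keys_sum_def additive.zero)

lemma additive_sum_fun:
  assumes "\<And>i. i \<in> A \<Longrightarrow> additive (f i)"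
  shows "additive (\<lambda>x. \<Sum>i\<in>A. f i x)"
  using assms by (auto intro!: additive.intro simp: additive.add sum.distrib)

lemma module_on_ring: "module ((*) :: 'r::comm_ring_1 \<Rightarrow> 'r \<Rightarrow> 'r)"
  by unfold_locales (auto simp: algebra_simps)

section \<open>Order complexes with a top element\<close>

lemma chain_bnd_eq_keys_sum:
  "chain_bnd = keys_sum (\<lambda>xs c. \<Sum>j<length xs. Poly_Mapping.single (delete_at j xs) ((-1) ^ j * c))"
  by (rule ext) (simp add: chain_bnd_def keys_sum_def)

lemma additive_chain_term:
  "additive (\<lambda>c::'k::field. \<Sum>j<n. Poly_Mapping.single (g j) ((-1) ^ j * c))"
  by (intro additive_sum_fun additive.intro) (simp add: single_add distrib_left)

lemma additive_chain_bnd: "additive chain_bnd"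
  unfolding chain_bnd_eq_keys_sum by (intro additive_keys_sum additive_chain_term)

lemma chain_bnd_single:
  "chain_bnd (Poly_Mapping.single xs c)
    = (\<Sum>j<length xs. Poly_Mapping.single (delete_at j xs) ((-1) ^ j * c))"
  unfolding chain_bnd_eq_keys_sum by (subst keys_sum_single) (rule additive_chain_term refl)+

text \<open>The face without the head is split off; the remaining positions move by one, which flips
  every sign.\<close>

lemma chain_bnd_single_Cons:
  "chain_bnd (Poly_Mapping.single (x # xs) c) = Poly_Mapping.single xs c
    - (\<Sum>j<length xs. Poly_Mapping.single (x # delete_at j xs) ((-1) ^ j * c))"
  by (simp add: chain_bnd_single sum.lessThan_Suc_shift delete_at_def single_uminus sum_negf del: sum.lessThan_Suc)

lemma set_delete_at_subset: "set (delete_at j xs) \<subseteq> set xs"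
  by (auto simp: delete_at_def dest: in_set_takeD in_set_dropD)

text \<open>Prefixes the top element t to a chain. A chain that already contains t goes to 0, since
  prefixing t again would break strict descent.\<close>

definition cone :: "'p \<Rightarrow> ('p list \<Rightarrow>\<^sub>0 'k::field) \<Rightarrow> ('p list \<Rightarrow>\<^sub>0 'k)"
  where "cone t = keys_sum (\<lambda>xs c. if t \<in> set xs then 0 else Poly_Mapping.single (t # xs) c)"

lemma additive_cone_term:
  "additive (\<lambda>c. if t \<in> set xs then 0 else Poly_Mapping.single (t # xs) c)"
  by unfold_locales (simp add: single_add)

lemma additive_cone: "additive (cone t)"
  unfolding cone_def by (intro additive_keys_sum additive_cone_term)

lemma cone_single:
  "cone t (Poly_Mapping.single xs c) = (if t \<in> set xs then 0 else Poly_Mapping.single (t # xs) c)"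
  unfolding cone_def by (subst keys_sum_single) (rule additive_cone_term refl)+

text \<open>The cone operator is a contracting homotopy of the reduced complex. If t is not in the
  chain xs, deleting the head of t # xs gives back xs and all other faces cancel against the cone of
  the boundary. If xs starts with t, its cone is 0 and the only face of xs without t is its tail,
  whose cone is xs.\<close>

lemma cone_homotopy:
  fixes f :: "'p list \<Rightarrow>\<^sub>0 'k::field"
  assumes "finite_poset J le" and "t \<in> J" and "\<And>x. x \<in> J \<Longrightarrow> le x t"
    and "Poly_Mapping.keys f \<subseteq> chains J le k"
  shows "chain_bnd (cone t f) + cone t (chain_bnd f) = f"
proof (rule poly_mapping_sum_induct[where h = f])
  show "chain_bnd (cone t 0) + cone t (chain_bnd 0) = 0"
    by (simp add: additive.zero[OF additive_cone] additive.zero[OF additive_chain_bnd])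
next
  fix f g :: "'p list \<Rightarrow>\<^sub>0 'k"
  assume "chain_bnd (cone t f) + cone t (chain_bnd f) = f"
    and "chain_bnd (cone t g) + cone t (chain_bnd g) = g"
  then show "chain_bnd (cone t (f + g)) + cone t (chain_bnd (f + g)) = f + g"
    by (simp add: additive.add[OF additive_cone] additive.add[OF additive_chain_bnd] algebra_simps)
next
  fix xs
  \<comment> \<open>Only terms of f itself have to be checked, which is what supplies the chain
    condition for xs.\<close>
  assume "xs \<in> Poly_Mapping.keys f"
  then have xs: "set xs \<subseteq> J" "sorted_wrt (\<lambda>x y. le y x \<and> y \<noteq> x) xs"
    using assms(4) by (auto simp: chains_def)
  define c where "c = Poly_Mapping.lookup f xs"
  note lin = additive.sum[OF additive_cone] additive.diff[OF additive_cone]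
    additive.diff[OF additive_chain_bnd] additive.zero[OF additive_chain_bnd]
  have *: "cone t (chain_bnd (Poly_Mapping.single ys c))
      = (\<Sum>j<length ys. Poly_Mapping.single (t # delete_at j ys) ((-1) ^ j * c))"
    if "t \<notin> set ys" for ys
  proof -
    have "t \<notin> set (delete_at j ys)" for j
      using that set_delete_at_subset by fastforce
    then show ?thesis
      by (simp add: chain_bnd_single lin cone_single)
  qed
  show "chain_bnd (cone t (Poly_Mapping.single xs (Poly_Mapping.lookup f xs)))
      + cone t (chain_bnd (Poly_Mapping.single xs (Poly_Mapping.lookup f xs)))
      = Poly_Mapping.single xs (Poly_Mapping.lookup f xs)"
    unfolding c_def[symmetric]
  proof (cases "t \<in> set xs")
    case False
    then show "chain_bnd (cone t (Poly_Mapping.single xs c))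
      + cone t (chain_bnd (Poly_Mapping.single xs c)) = Poly_Mapping.single xs c"
      by (simp add: * cone_single chain_bnd_single_Cons)
  next
    case True
    then obtain x ys where xs_eq: "xs = x # ys"
      by (cases xs) auto
    \<comment> \<open>A later position of t would give t < x, against antisymmetry, because t is the
      top.\<close>
    have "x = t"
    proof (rule ccontr)
      assume "x \<noteq> t"
      with True xs xs_eq have "t \<in> set ys" "le t x" "x \<in> J"
        by auto
      with assms \<open>x \<noteq> t\<close> show False
        unfolding finite_poset_def by blast
    qed
    with xs xs_eq have "xs = t # ys" "t \<notin> set ys"
      by auto
    then show "chain_bnd (cone t (Poly_Mapping.single xs c))
      + cone t (chain_bnd (Poly_Mapping.single xs c)) = Poly_Mapping.single xs c"
      by (simp add: chain_bnd_single_Cons cone_single lin)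
  qed
qed

lemma keys_cone_subset:
  fixes f :: "'p list \<Rightarrow>\<^sub>0 'k::field"
  assumes "t \<in> J" and "\<And>x. x \<in> J \<Longrightarrow> le x t" and "Poly_Mapping.keys f \<subseteq> chains J le k"
  shows "Poly_Mapping.keys (cone t f) \<subseteq> chains J le (k + 1)"
proof (rule poly_mapping_sum_induct[where h = f])
  show "Poly_Mapping.keys (cone t 0) \<subseteq> chains J le (k + 1)"
    by (simp add: additive.zero[OF additive_cone])
next
  fix f g :: "'p list \<Rightarrow>\<^sub>0 'k"
  assume "Poly_Mapping.keys (cone t f) \<subseteq> chains J le (k + 1)"
    "Poly_Mapping.keys (cone t g) \<subseteq> chains J le (k + 1)"
  then show "Poly_Mapping.keys (cone t (f + g)) \<subseteq> chains J le (k + 1)"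
    using keys_add[of "cone t f" "cone t g"] by (auto simp: additive.add[OF additive_cone])
next
  fix xs
  assume "xs \<in> Poly_Mapping.keys f"
  with assms have "xs \<in> chains J le k"
    by auto
  then have "t \<notin> set xs \<Longrightarrow> t # xs \<in> chains J le (k + 1)"
    using assms(1,2) by (auto simp: chains_def subset_iff)
  then show "Poly_Mapping.keys (cone t (Poly_Mapping.single xs (Poly_Mapping.lookup f xs)))
      \<subseteq> chains J le (k + 1)"
    by (simp add: cone_single)
qed

lemma order_complex_acyclic_of_top:
  assumes "finite_poset J le" and "t \<in> J" and "\<And>x. x \<in> J \<Longrightarrow> le x t"
  shows "cycles (order_complex J le) k \<subseteq> boundaries (order_complex J le) k"
proof
  fix f
  assume "f \<in> cycles (order_complex J le) k"
  then have f: "Poly_Mapping.keys f \<subseteq> chains J le k" "chain_bnd f = 0"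
    by (auto simp: cycles_def order_complex_def)
  have "f = chain_bnd (cone t f)"
    using cone_homotopy[OF assms f(1)] f(2) by (simp add: additive.zero[OF additive_cone])
  then show "f \<in> boundaries (order_complex J le) k"
    using keys_cone_subset[OF assms(2,3) f(1)] by (auto simp: boundaries_def order_complex_def)
qed

section \<open>Exactness read off from sets of cosets\<close>

lemma coset_eq_iff:
  assumes "0 \<in> B" and "\<And>x y. x \<in> B \<Longrightarrow> y \<in> B \<Longrightarrow> x - y \<in> B"
  shows "coset B x = coset B y \<longleftrightarrow> x - y \<in> B"
proof
  assume "coset B x = coset B y"
  then have "x \<in> coset B y"
    using assms(1) by (force simp: coset_def)
  then show "x - y \<in> B"
    by (auto simp: coset_def)
next
  assume xy: "x - y \<in> B"
  have neg: "- b \<in> B" if "b \<in> B" for b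
    using assms(2)[OF assms(1) that] by simp
  have add: "a + b \<in> B" if "a \<in> B" "b \<in> B" for a b
    using assms(2)[OF that(1) neg[OF that(2)]] by simp
  show "coset B x = coset B y"
  proof (intro set_eqI iffI)
    fix z assume "z \<in> coset B x"
    then obtain b where "b \<in> B" "z = x + b"
      by (auto simp: coset_def)
    then have "z = y + ((x - y) + b)" "(x - y) + b \<in> B"
      using add xy by auto
    then show "z \<in> coset B y"
      unfolding coset_def by blast
  next
    fix z assume "z \<in> coset B y"
    then obtain b where "b \<in> B" "z = y + b"
      by (auto simp: coset_def)
    then have "z = x + (b - (x - y))" "b - (x - y) \<in> B"
      using assms(2) xy by auto
    then show "z \<in> coset B x"
      unfolding coset_def by blast
  qed
qed

lemma homology_subset_singleton:
  assumes "cycles Y k \<subseteq> boundaries Y k" and "0 \<in> boundaries Y k"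
    and "\<And>x y. x \<in> boundaries Y k \<Longrightarrow> y \<in> boundaries Y k \<Longrightarrow> x - y \<in> boundaries Y k"
  shows "homology Y k \<subseteq> {boundaries Y k}"
proof -
  have "coset (boundaries Y k) z = boundaries Y k" if "z \<in> cycles Y k" for z
  proof -
    have "coset (boundaries Y k) z = coset (boundaries Y k) 0"
      using assms that by (subst coset_eq_iff) auto
    then show ?thesis
      by (simp add: coset_def)
  qed
  then show ?thesis
    by (auto simp: homology_def)
qed

text \<open>A set that injects into a one-element set has at most one element, so every cycle has
  the class of 0. This converts (S2), a bijection between sets of cosets, into exactness.\<close>

lemma boundaries_of_homology_inj:
  assumes "inj_on H (homology Y k)" and "H ` homology Y k \<subseteq> {B}"
    and "0 \<in> cycles Y k" and "0 \<in> boundaries Y k"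
  shows "cycles Y k \<subseteq> boundaries Y k"
proof
  fix z
  assume z: "z \<in> cycles Y k"
  have "coset (boundaries Y k) z = coset (boundaries Y k) 0"
  proof (rule inj_onD[OF assms(1)])
    show "coset (boundaries Y k) z \<in> homology Y k" "coset (boundaries Y k) 0 \<in> homology Y k"
      using z assms(3) by (auto simp: homology_def)
    then show "H (coset (boundaries Y k) z) = H (coset (boundaries Y k) 0)"
      using assms(2) by blast
  qed
  then have "z + 0 \<in> coset (boundaries Y k) 0"
    using assms(4) unfolding coset_def by blast
  then show "z \<in> boundaries Y k"
    by (simp add: coset_def)
qed

section \<open>Modules of polynomials with vector coefficients\<close>

text \<open>
  \<open>coeff_sum\<close> substitutes \<open>1\<close> for all variables. It is injective on each multidegree of
  \<open>F_i\<close> and identifies it with a space of chains of the synor complex.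
\<close>

definition coeff_sum :: "('x \<Rightarrow>\<^sub>0 'b) \<Rightarrow> 'b::ab_group_add"
  where "coeff_sum = keys_sum (\<lambda>_ v. v)"

lemma additive_coeff_sum: "additive coeff_sum"
  unfolding coeff_sum_def by (intro additive_keys_sum additive.intro) simp

lemma coeff_sum_single [simp]: "coeff_sum (Poly_Mapping.single k v) = v"
  by (simp add: coeff_sum_def keys_sum_def)

text \<open>The direct sum of the modules V m \<otimes> S(-m) for an arbitrary family V of
  coefficient spaces. F_i is the case \<open>V = synor_coeffs Q X i\<close>; freeness and the
  multigrading can thus be treated without any differential.\<close>

definition coeff_module :: "('n mono \<Rightarrow> 'b set) \<Rightarrow> ('n mono \<times> 'n mono \<Rightarrow>\<^sub>0 'b::ab_group_add) set"
  where "coeff_module V = {h. \<forall>m a. Poly_Mapping.lookup h (m, a) \<in> V m}"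

definition multidegree_part ::
  "('n mono \<Rightarrow> 'b set) \<Rightarrow> 'n mono \<Rightarrow> ('n mono \<times> 'n mono \<Rightarrow>\<^sub>0 'b::ab_group_add) set"
  where "multidegree_part V u = {h \<in> coeff_module V. \<forall>(m, a)\<in>Poly_Mapping.keys h. m + a = u}"

lemma multidegree_partD: "h \<in> multidegree_part V u \<Longrightarrow> h \<in> coeff_module V"
  by (simp add: multidegree_part_def)

context vector_space
begin

lemma poly_smul_eq_keys_sum:
  "poly_smul scale p h =
    keys_sum (\<lambda>b c. keys_sum (\<lambda>k v. Poly_Mapping.single (fst k, b + snd k) (scale c v)) h) p"
  by (simp add: poly_smul_def keys_sum_def case_prod_unfold)

lemma additive_poly_smul_right: "additive (poly_smul scale p)"
proof
  fix g h
  show "poly_smul scale p (g + h) = poly_smul scale p g + poly_smul scale p h"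
    unfolding poly_smul_eq_keys_sum
    by (subst additive.add[OF additive_keys_sum])
      (auto simp: keys_sum_def single_add scale_right_distrib sum.distrib intro!: additive.intro)
qed

lemma additive_poly_smul_left: "additive (\<lambda>p. poly_smul scale p h)"
  unfolding poly_smul_eq_keys_sum
  by (rule additive_keys_sum)
    (auto simp: keys_sum_def single_add scale_left_distrib sum.distrib intro!: additive.intro)

lemma poly_smul_single_single:
  "poly_smul scale (Poly_Mapping.single b c) (Poly_Mapping.single (m, a) v)
    = Poly_Mapping.single (m, b + a) (scale c v)"
  by (auto simp: poly_smul_def scale_zero_left)

lemmas poly_smul_add_right = additive.add[OF additive_poly_smul_right]
lemmas poly_smul_add_left = additive.add[OF additive_poly_smul_left]
lemmas poly_smul_zero_right = additive.zero[OF additive_poly_smul_right]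
lemmas poly_smul_zero_left = additive.zero[OF additive_poly_smul_left]

lemma poly_smul_one: "poly_smul scale 1 h = h"
proof (rule poly_mapping_induct_single[where h = h])
  show "poly_smul scale 1 (Poly_Mapping.single k v) = Poly_Mapping.single k v" for k v
    using poly_smul_single_single[of 0 1 "fst k" "snd k" v] by simp
qed (simp add: poly_smul_add_right)

lemma poly_smul_assoc: "poly_smul scale (p * q) h = poly_smul scale p (poly_smul scale q h)"
proof (rule poly_mapping_induct_single[where h = h])
  fix k v
  show "poly_smul scale (p * q) (Poly_Mapping.single k v)
      = poly_smul scale p (poly_smul scale q (Poly_Mapping.single k v))"
  proof (rule poly_mapping_induct_single[where h = p])
    fix b c
    show "poly_smul scale (Poly_Mapping.single b c * q) (Poly_Mapping.single k v)
      = poly_smul scale (Poly_Mapping.single b c) (poly_smul scale q (Poly_Mapping.single k v))"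
    proof (rule poly_mapping_induct_single[where h = q])
      fix b' c'
      show "poly_smul scale (Poly_Mapping.single b c * Poly_Mapping.single b' c')
          (Poly_Mapping.single k v)
        = poly_smul scale (Poly_Mapping.single b c)
          (poly_smul scale (Poly_Mapping.single b' c') (Poly_Mapping.single k v))"
        by (cases k) (simp add: mult_single poly_smul_single_single add.assoc)
    qed (simp add: poly_smul_add_left poly_smul_add_right distrib_left)
  qed (simp add: poly_smul_add_left distrib_right)
qed (simp add: poly_smul_add_right)

lemma module_poly_smul: "module (poly_smul scale)"
  by unfold_locales (simp_all add: poly_smul_add_left poly_smul_add_right poly_smul_assoc poly_smul_one)

text \<open>Restriction of scalars to the constants: a single multidegree is a K-subspace, but in
  general no S-submodule.\<close>

lemma module_poly_smul_const: "module (\<lambda>c. poly_smul scale (Poly_Mapping.single 0 c))"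
  by unfold_locales
    (simp_all add: poly_smul_add_left poly_smul_add_right single_add poly_smul_one
      poly_smul_assoc[symmetric] mult_single)

text \<open>Reads off one coefficient of p(v \<otimes> 1). It reduces S-linear relations among such
  generators to K-linear relations, one for each exponent.\<close>

lemma lookup_poly_smul_single_right:
  "Poly_Mapping.lookup (poly_smul scale p (Poly_Mapping.single (m, 0) v)) (m', a)
    = (if m' = m then scale (Poly_Mapping.lookup p a) v else 0)"
  by (rule poly_mapping_induct_single[where h = p])
    (auto simp: poly_smul_add_left lookup_add scale_left_distrib poly_smul_single_single
      lookup_single when_def)

lemma keys_poly_smul_single:
  "Poly_Mapping.keys (poly_smul scale (Poly_Mapping.single b c) h)
    \<subseteq> (\<lambda>(m, a). (m, b + a)) ` Poly_Mapping.keys h"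
proof (rule poly_mapping_sum_induct[where h = h and
      P = "\<lambda>g. Poly_Mapping.keys (poly_smul scale (Poly_Mapping.single b c) g)
        \<subseteq> (\<lambda>(m, a). (m, b + a)) ` Poly_Mapping.keys h"])
  fix f g :: "('c \<Rightarrow>\<^sub>0 nat) \<times> ('c \<Rightarrow>\<^sub>0 nat) \<Rightarrow>\<^sub>0 'b"
  let ?K = "\<lambda>g. Poly_Mapping.keys (poly_smul scale (Poly_Mapping.single b c) g)"
  assume "?K f \<subseteq> (\<lambda>(m, a). (m, b + a)) ` Poly_Mapping.keys h"
    and "?K g \<subseteq> (\<lambda>(m, a). (m, b + a)) ` Poly_Mapping.keys h"
  then show "?K (f + g) \<subseteq> (\<lambda>(m, a). (m, b + a)) ` Poly_Mapping.keys h"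
    using keys_add[of "poly_smul scale (Poly_Mapping.single b c) f"
        "poly_smul scale (Poly_Mapping.single b c) g"]
    unfolding poly_smul_add_right by blast
next
  fix k
  assume "k \<in> Poly_Mapping.keys h"
  then show "Poly_Mapping.keys (poly_smul scale (Poly_Mapping.single b c)
      (Poly_Mapping.single k (Poly_Mapping.lookup h k)))
    \<subseteq> (\<lambda>(m, a). (m, b + a)) ` Poly_Mapping.keys h"
    by (cases k) (auto simp: poly_smul_single_single image_iff intro: bexI[of _ k])
qed (simp add: poly_smul_zero_right)

context
  fixes V :: "'n mono \<Rightarrow> 'b set"
  assumes subV: "\<And>m. subspace (V m)"
begin

lemma zero_in_coeff_module: "0 \<in> coeff_module V"
  using subV by (auto simp: coeff_module_def subspace_0)

lemma add_in_coeff_module: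
  "g \<in> coeff_module V \<Longrightarrow> h \<in> coeff_module V \<Longrightarrow> g + h \<in> coeff_module V"
  using subV by (auto simp: coeff_module_def subspace_add lookup_add)

lemma single_in_coeff_module: "v \<in> V m \<Longrightarrow> Poly_Mapping.single (m, a) v \<in> coeff_module V"
  using subV by (auto simp: coeff_module_def subspace_0 lookup_single when_def)

lemma coeff_module_induct [consumes 1, case_names zero add single]:
  assumes "h \<in> coeff_module V" and "P 0"
    and "\<And>f g. f \<in> coeff_module V \<Longrightarrow> g \<in> coeff_module V \<Longrightarrow> P f \<Longrightarrow> P g \<Longrightarrow> P (f + g)"
    and "\<And>m a v. v \<in> V m \<Longrightarrow> P (Poly_Mapping.single (m, a) v)"
  shows "P h"
proof -
  have "h \<in> coeff_module V \<and> P h"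
  proof (rule poly_mapping_sum_induct[where h = h])
    fix k
    have "Poly_Mapping.lookup h k \<in> V (fst k)"
      using assms(1) by (cases k) (simp add: coeff_module_def)
    then show "Poly_Mapping.single k (Poly_Mapping.lookup h k) \<in> coeff_module V
        \<and> P (Poly_Mapping.single k (Poly_Mapping.lookup h k))"
      by (cases k) (simp add: single_in_coeff_module assms(4))
  qed (use assms in \<open>auto simp: zero_in_coeff_module add_in_coeff_module\<close>)
  then show ?thesis ..
qed

lemma poly_smul_in_coeff_module:
  assumes "h \<in> coeff_module V"
  shows "poly_smul scale p h \<in> coeff_module V"
proof (rule poly_mapping_induct_single[where h = p])
  fix b c
  show "poly_smul scale (Poly_Mapping.single b c) h \<in> coeff_module V"
    using assms
  proof (induction h rule: coeff_module_induct)
    case zero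
    then show ?case
      by (simp add: poly_smul_zero_right zero_in_coeff_module)
  next
    case (add f g)
    then show ?case
      by (simp add: poly_smul_add_right add_in_coeff_module)
  next
    case (single m a v)
    then show ?case
      by (simp add: poly_smul_single_single single_in_coeff_module subspace_scale[OF subV])
  qed
qed (simp add: poly_smul_add_left add_in_coeff_module)

lemma subspace_coeff_module: "module.subspace (poly_smul scale) (coeff_module V)"
  unfolding module.subspace_def[OF module_poly_smul]
  by (auto intro: zero_in_coeff_module add_in_coeff_module poly_smul_in_coeff_module)

lemma zero_in_multidegree_part: "0 \<in> multidegree_part V u"
  by (auto simp: multidegree_part_def zero_in_coeff_module)

lemma add_in_multidegree_part:
  assumes "g \<in> multidegree_part V u" "h \<in> multidegree_part V u"
  shows "g + h \<in> multidegree_part V u"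
  using assms keys_add[of g h] by (auto simp: multidegree_part_def add_in_coeff_module)

lemma sum_in_multidegree_part:
  assumes "\<And>i. i \<in> I \<Longrightarrow> f i \<in> multidegree_part V u"
  shows "(\<Sum>i\<in>I. f i) \<in> multidegree_part V u"
  using assms
  by (induction I rule: infinite_finite_induct)
    (auto intro: zero_in_multidegree_part add_in_multidegree_part)

lemma single_in_multidegree_part:
  "v \<in> V m \<Longrightarrow> m + a = u \<Longrightarrow> Poly_Mapping.single (m, a) v \<in> multidegree_part V u"
  by (auto simp: multidegree_part_def single_in_coeff_module)

lemma poly_smul_single_in_multidegree_part:
  assumes "h \<in> multidegree_part V u"
  shows "poly_smul scale (Poly_Mapping.single b c) h \<in> multidegree_part V (u + b)"
proof -
  have "m + a = u + b" if "(m, a) \<in> Poly_Mapping.keys (poly_smul scale (Poly_Mapping.single b c) h)" for m a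
  proof -
    from that keys_poly_smul_single[of b c h] obtain a'
      where "a = b + a'" "(m, a') \<in> Poly_Mapping.keys h"
      by auto
    with assms show ?thesis
      by (auto simp: multidegree_part_def ac_simps)
  qed
  with assms show ?thesis
    by (auto simp: multidegree_part_def poly_smul_in_coeff_module)
qed

lemma subspace_multidegree_part:
  "module.subspace (\<lambda>c. poly_smul scale (Poly_Mapping.single 0 c)) (multidegree_part V u)"
  unfolding module.subspace_def[OF module_poly_smul_const]
  using poly_smul_single_in_multidegree_part[where b = 0]
  by (auto intro: zero_in_multidegree_part add_in_multidegree_part)

lemma diff_in_multidegree_part:
  assumes "g \<in> multidegree_part V u" "h \<in> multidegree_part V u"
  shows "g - h \<in> multidegree_part V u"
  using module.subspace_diff[OF module_poly_smul_const subspace_multidegree_part] assms .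

lemma multidegree_part_induct [consumes 1, case_names zero add single]:
  assumes "h \<in> multidegree_part V u" and "P 0"
    and "\<And>f g. f \<in> multidegree_part V u \<Longrightarrow> g \<in> multidegree_part V u \<Longrightarrow> P f \<Longrightarrow> P g \<Longrightarrow> P (f + g)"
    and "\<And>m a v. v \<in> V m \<Longrightarrow> m + a = u \<Longrightarrow> P (Poly_Mapping.single (m, a) v)"
  shows "P h"
proof -
  have "h \<in> multidegree_part V u \<and> P h"
  proof (rule poly_mapping_sum_induct[where h = h])
    fix k
    assume "k \<in> Poly_Mapping.keys h"
    then have "Poly_Mapping.lookup h k \<in> V (fst k)" "fst k + snd k = u"
      using assms(1) by (cases k; auto simp: multidegree_part_def coeff_module_def)+
    then show "Poly_Mapping.single k (Poly_Mapping.lookup h k) \<in> multidegree_part V u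
        \<and> P (Poly_Mapping.single k (Poly_Mapping.lookup h k))"
      by (cases k) (simp add: single_in_multidegree_part assms(4))
  qed (use assms in \<open>auto simp: zero_in_multidegree_part add_in_multidegree_part\<close>)
  then show ?thesis ..
qed

text \<open>Every key (m, a) has exactly one multidegree m + a. Grouping the terms of h by it yields
  the decomposition, and in a sum of homogeneous parts each key can occur in only one
  summand.\<close>

lemma coeff_module_direct_sum: "is_direct_sum (coeff_module V) (multidegree_part V) UNIV"
  unfolding is_direct_sum_def
proof (intro conjI allI impI)
  show "coeff_module V = family_sum (multidegree_part V) UNIV"
  proof
    show "family_sum (multidegree_part V) UNIV \<subseteq> coeff_module V"
      unfolding family_sum_def
      by (auto intro!: module.subspace_sum[OF module_poly_smul subspace_coeff_module]
          intro: multidegree_partD)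
  next
    show "coeff_module V \<subseteq> family_sum (multidegree_part V) UNIV"
    proof
      fix h
      assume h: "h \<in> coeff_module V"
      define d where "d = (\<lambda>k :: 'n mono \<times> 'n mono. fst k + snd k)"
      define f where "f u = (\<Sum>k | k \<in> Poly_Mapping.keys h \<and> d k = u.
        Poly_Mapping.single k (Poly_Mapping.lookup h k))" for u
      have "(\<Sum>u\<in>d ` Poly_Mapping.keys h. f u)
          = (\<Sum>k\<in>Poly_Mapping.keys h. Poly_Mapping.single k (Poly_Mapping.lookup h k))"
        unfolding f_def by (rule sum.group) auto
      also have "\<dots> = h"
        by (rule poly_mapping_eqI)
          (auto simp: lookup_sum lookup_single when_def in_keys_iff if_distrib cong: if_cong)
      finally have "h = (\<Sum>u\<in>d ` Poly_Mapping.keys h. f u)" ..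
      moreover have "f u \<in> multidegree_part V u" for u
        unfolding f_def
      proof (rule sum_in_multidegree_part)
        fix k
        assume "k \<in> {k \<in> Poly_Mapping.keys h. d k = u}"
        then show "Poly_Mapping.single k (Poly_Mapping.lookup h k) \<in> multidegree_part V u"
          using h by (cases k) (auto simp: d_def coeff_module_def intro: single_in_multidegree_part)
      qed
      ultimately show "h \<in> family_sum (multidegree_part V) UNIV"
        unfolding family_sum_def mem_Collect_eq
        by (intro exI[of _ "d ` Poly_Mapping.keys h"] exI[of _ f]) auto
    qed
  qed
next
  fix T f
  assume T: "finite T \<and> T \<subseteq> UNIV \<and> (\<forall>u\<in>T. f u \<in> multidegree_part V u) \<and> (\<Sum>u\<in>T. f u) = 0"
  show "\<forall>u\<in>T. f u = 0"
  proof (intro ballI poly_mapping_eqI)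
    fix u k
    assume u: "u \<in> T"
    have other: "Poly_Mapping.lookup (f w) k = 0" if "w \<in> T" "fst k + snd k \<noteq> w" for w
    proof (rule ccontr)
      assume "Poly_Mapping.lookup (f w) k \<noteq> 0"
      then have "k \<in> Poly_Mapping.keys (f w)"
        by (simp add: in_keys_iff)
      moreover have "f w \<in> multidegree_part V w"
        using T that by blast
      ultimately show False
        using that(2) by (auto simp: multidegree_part_def)
    qed
    show "Poly_Mapping.lookup (f u) k = Poly_Mapping.lookup 0 k"
    proof (cases "fst k + snd k = u")
      case True
      have "Poly_Mapping.lookup (f u) k = (\<Sum>w\<in>{u}. Poly_Mapping.lookup (f w) k)"
        by simp
      also have "\<dots> = (\<Sum>w\<in>T. Poly_Mapping.lookup (f w) k)"
        by (rule sum.mono_neutral_left) (use T u True other in auto)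
      also have "\<dots> = 0"
        using T by (simp flip: lookup_sum)
      finally show ?thesis
        by simp
    qed (use other u in auto)
  qed
qed

text \<open>K-bases of the coefficient spaces V m give an S-basis of elements b \<otimes> 1: they
  span because cb \<otimes> x^a = (c x^a)(b \<otimes> 1), and independence is inherited coefficient
  by coefficient.\<close>

lemma free_basis_coeff_module:
  assumes "finite M" and "\<And>m. m \<notin> M \<Longrightarrow> Bs m = {}"
    and indep: "\<And>m. independent (Bs m)" and span: "\<And>m. span (Bs m) = V m"
  shows "free_basis (poly_smul scale) (coeff_module V) (\<Union>m\<in>M. Poly_Mapping.single (m, 0) ` Bs m)"
    (is "free_basis _ _ ?E")
proof -
  interpret F: module "poly_smul scale"
    by (rule module_poly_smul)
  have "\<not> F.dependent ?E"
  proof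
    assume "F.dependent ?E"
    then obtain T w e0 where T: "finite T" "T \<subseteq> ?E" "(\<Sum>e\<in>T. poly_smul scale (w e) e) = 0"
      and e0: "e0 \<in> T" "w e0 \<noteq> 0"
      unfolding F.dependent_explicit by blast
    from e0 T obtain m b0 where m: "m \<in> M" "b0 \<in> Bs m" "e0 = Poly_Mapping.single (m, 0) b0"
      by blast
    have inj: "inj_on (Poly_Mapping.single (m, 0)) X" for X :: "'b set"
      by (meson inj_single inj_on_subset subset_UNIV)
    define T' where "T' = {b \<in> Bs m. Poly_Mapping.single (m, 0) b \<in> T}"
    have fin: "finite T'"
      by (rule finite_imageD[OF _ inj]) (use T(1) in \<open>auto simp: T'_def intro: finite_subset\<close>)
    \<comment> \<open>At the key (m, a), generators of other indices contribute nothing, and the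
      S-linear relation becomes a K-linear relation among the vectors of
      \<open>Bs m\<close>.\<close>
    have "Poly_Mapping.lookup (w e0) a = 0" for a
    proof -
      have "0 = (\<Sum>e\<in>T. Poly_Mapping.lookup (poly_smul scale (w e) e) (m, a))"
        using T(3) by (simp flip: lookup_sum)
      also have "\<dots> = (\<Sum>e\<in>Poly_Mapping.single (m, 0) ` T'.
          Poly_Mapping.lookup (poly_smul scale (w e) e) (m, a))"
      proof (rule sum.mono_neutral_right)
        show "\<forall>e\<in>T - Poly_Mapping.single (m, 0) ` T'.
            Poly_Mapping.lookup (poly_smul scale (w e) e) (m, a) = 0"
        proof
          fix e
          assume e: "e \<in> T - Poly_Mapping.single (m, 0) ` T'"
          then obtain m' b where m': "b \<in> Bs m'" "e = Poly_Mapping.single (m', 0) b"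
            using T(2) by blast
          with e have "m' \<noteq> m"
            by (auto simp: T'_def)
          with m' show "Poly_Mapping.lookup (poly_smul scale (w e) e) (m, a) = 0"
            by (simp add: lookup_poly_smul_single_right)
        qed
      qed (use T(1) in \<open>auto simp: T'_def\<close>)
      also have "\<dots> = (\<Sum>b\<in>T'. scale (Poly_Mapping.lookup (w (Poly_Mapping.single (m, 0) b)) a) b)"
        by (simp add: sum.reindex[OF inj] lookup_poly_smul_single_right)
      finally have "Poly_Mapping.lookup (w (Poly_Mapping.single (m, 0) b)) a = 0" if "b \<in> T'" for b
        using independentD[OF indep fin, of m "\<lambda>b. Poly_Mapping.lookup (w (Poly_Mapping.single (m, 0) b)) a" b]
          that by (auto simp: T'_def)
      then show ?thesis
        using m e0 by (auto simp: T'_def)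
    qed
    then have "w e0 = 0"
      by (intro poly_mapping_eqI) simp
    with e0 show False
      by simp
  qed
  moreover have "F.span ?E = coeff_module V"
  proof
    show "F.span ?E \<subseteq> coeff_module V"
      by (rule F.span_minimal[OF _ subspace_coeff_module])
        (use span span_base in \<open>auto intro!: single_in_coeff_module\<close>)
  next
    show "coeff_module V \<subseteq> F.span ?E"
    proof
      fix h
      assume "h \<in> coeff_module V"
      then show "h \<in> F.span ?E"
      proof (induction h rule: coeff_module_induct)
        case (single m a v)
        then have "v \<in> span (Bs m)"
          by (simp add: span)
        then show ?case
        proof (induction v rule: span_induct_alt)
          case (step c b v)
          then have "m \<in> M"
            using assms(2) by blast
          with step have "poly_smul scale (Poly_Mapping.single a c) (Poly_Mapping.single (m, 0) b) \<in> F.span ?E"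
            by (intro F.span_scale F.span_base) auto
          then show ?case
            using step by (auto simp: single_add poly_smul_single_single intro: F.span_add)
        qed (simp add: F.span_zero)
      qed (auto intro: F.span_zero F.span_add)
    qed
  qed
  ultimately show ?thesis
    by (simp add: free_basis_def)
qed

end

end

section \<open>Monomial ideals and the LCM-lattice\<close>

lemma mono_dvd_iff: "mono_dvd a b \<longleftrightarrow> (\<forall>j. Poly_Mapping.lookup a j \<le> Poly_Mapping.lookup b j)"
proof
  assume "\<forall>j. Poly_Mapping.lookup a j \<le> Poly_Mapping.lookup b j"
  then have "b = a + (b - a)"
    by (intro poly_mapping_eqI) (simp add: lookup_add lookup_minus)
  then show "mono_dvd a b"
    unfolding mono_dvd_def ..
qed (auto simp: mono_dvd_def lookup_add)

lemma mono_dvd_refl: "mono_dvd a a"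
  by (simp add: mono_dvd_iff)

lemma mono_dvd_trans: "mono_dvd a b \<Longrightarrow> mono_dvd b c \<Longrightarrow> mono_dvd a c"
  unfolding mono_dvd_iff by (meson order_trans)

lemma mono_dvd_antisym: "mono_dvd a b \<Longrightarrow> mono_dvd b a \<Longrightarrow> a = b"
  unfolding mono_dvd_iff by (intro poly_mapping_eqI) (meson order_antisym)

text \<open>Subtraction of exponents is truncated at 0; divisibility makes it exact.\<close>

lemma mono_dvd_add_diff: "mono_dvd a b \<Longrightarrow> a + (b - a) = b"
  unfolding mono_dvd_iff by (intro poly_mapping_eqI) (simp add: lookup_add lookup_minus)

lemma mono_dvd_zero_iff: "mono_dvd a 0 \<longleftrightarrow> a = 0"
  by (auto simp: mono_dvd_iff intro: poly_mapping_eqI)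

text \<open>Membership in a monomial ideal is decided term by term. The right side is an ideal
  because a product has only keys that are multiples of keys of each factor; conversely each term of
  p is a multiple of a generator. From here on ideals are handled through divisibility
  alone.\<close>

lemma ideal_gen_mono_poly:
  "ideal_gen (mono_poly ` G) = {p :: ('n, 'k::field) mpoly. \<forall>a\<in>Poly_Mapping.keys p. \<exists>g\<in>G. mono_dvd g a}"
    (is "_ = ?I")
proof -
  interpret module "(*) :: ('n, 'k) mpoly \<Rightarrow> _"
    by (rule module_on_ring)
  show ?thesis
    unfolding ideal_gen_def
  proof
    have "subspace ?I"
      unfolding subspace_def
    proof (intro conjI allI ballI)
      fix p q :: "('n, 'k) mpoly"
      assume "p \<in> ?I" "q \<in> ?I"
      then show "p + q \<in> ?I"
        using keys_add[of p q] by blast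
    next
      fix c p :: "('n, 'k) mpoly"
      assume p: "p \<in> ?I"
      have "\<exists>g\<in>G. mono_dvd g a" if "a \<in> Poly_Mapping.keys (c * p)" for a
      proof -
        from that keys_mult[of c p] obtain a' b where "a = a' + b" "b \<in> Poly_Mapping.keys p"
          by blast
        with p obtain g where "g \<in> G" "mono_dvd g b"
          by blast
        moreover have "mono_dvd b a"
          unfolding mono_dvd_def \<open>a = a' + b\<close> by (intro exI[of _ a']) (simp add: add.commute)
        ultimately show ?thesis
          using mono_dvd_trans by blast
      qed
      then show "c * p \<in> ?I"
        by blast
    qed simp
    then show "span (mono_poly ` G) \<subseteq> ?I"
      by (rule span_minimal[rotated]) (auto simp: mono_poly_def intro: mono_dvd_refl)
  next
    show "?I \<subseteq> span (mono_poly ` G)"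
    proof
      fix p
      assume p: "p \<in> ?I"
      show "p \<in> span (mono_poly ` G)"
      proof (rule poly_mapping_sum_induct[where h = p])
        fix a
        assume "a \<in> Poly_Mapping.keys p"
        with p obtain g where g: "g \<in> G" "mono_dvd g a"
          by blast
        have "Poly_Mapping.single (a - g) (Poly_Mapping.lookup p a) * mono_poly g \<in> span (mono_poly ` G)"
          using g by (intro span_scale span_base) auto
        then show "Poly_Mapping.single a (Poly_Mapping.lookup p a) \<in> span (mono_poly ` G)"
          using mono_dvd_add_diff[OF g(2)] by (simp add: mono_poly_def mult_single add.commute)
      qed (auto intro: span_zero span_add)
    qed
  qed
qed

lemma mono_poly_in_ideal_gen_iff:
  "(mono_poly a :: ('n, 'k::field) mpoly) \<in> ideal_gen (mono_poly ` G) \<longleftrightarrow> (\<exists>g\<in>G. mono_dvd g a)"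
  by (simp add: ideal_gen_mono_poly) (simp add: mono_poly_def)

text \<open>A divisor of least total degree is minimal: with finitely many variables the total
  degree is a finite sum, and a proper divisor makes it strictly smaller.\<close>

lemma exists_minimal_divisor:
  fixes a :: "'n::finite mono"
  assumes "a \<in> M"
  obtains m where "m \<in> M" "mono_dvd m a" "\<And>b. b \<in> M \<Longrightarrow> mono_dvd b m \<Longrightarrow> b = m"
proof -
  define d where "d m = (\<Sum>j\<in>UNIV. Poly_Mapping.lookup m j)" for m :: "'n mono"
  from assms obtain m where m: "m \<in> M" "mono_dvd m a"
    and least: "\<And>b. b \<in> M \<Longrightarrow> mono_dvd b a \<Longrightarrow> d m \<le> d b"
    using ex_has_least_nat[of "\<lambda>m. m \<in> M \<and> mono_dvd m a" a d] mono_dvd_refl by blast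
  have "b = m" if b: "b \<in> M" "mono_dvd b m" for b
  proof -
    have "d m \<le> d b"
      using b m mono_dvd_trans least by blast
    moreover have "(\<Sum>j\<in>UNIV. Poly_Mapping.lookup b j) < (\<Sum>j\<in>UNIV. Poly_Mapping.lookup m j)" if "b \<noteq> m"
    proof (rule sum_strict_mono_ex1)
      show "\<exists>j\<in>UNIV. Poly_Mapping.lookup b j < Poly_Mapping.lookup m j"
        using b(2) that unfolding mono_dvd_iff
        by (metis UNIV_I le_neq_implies_less poly_mapping_eqI)
    qed (use b(2) in \<open>auto simp: mono_dvd_iff\<close>)
    ultimately show ?thesis
      unfolding d_def by fastforce
  qed
  with m that show thesis
    by blast
qed

text \<open>The definite description in \<open>min_mono_gens\<close> needs a unique irredundant
  generating set. The divisibility-minimal monomials of I generate I and lie in every monomial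
  generating set, so they form the least one.\<close>

lemma ideal_gen_min_mono_gens:
  fixes I :: "('n::finite, 'k::field) mpoly set"
  assumes "monomial_ideal I"
  shows "I = ideal_gen (mono_poly ` min_mono_gens I)"
proof -
  define M where "M = {a. (mono_poly a :: ('n, 'k) mpoly) \<in> I}"
  define G0 where "G0 = {a \<in> M. \<forall>b\<in>M. mono_dvd b a \<longrightarrow> b = a}"
  let ?gen = "\<lambda>G. I = ideal_gen (mono_poly ` G)"
  have G0_least: "G0 \<subseteq> H" if "?gen H" for H
  proof
    fix a
    assume "a \<in> G0"
    then have "mono_poly a \<in> ideal_gen (mono_poly ` H :: ('n, 'k) mpoly set)"
      using that by (simp add: G0_def M_def)
    \<comment> \<open>A generator dividing the minimal monomial a lies in I itself, hence equals
      a.\<close>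
    then obtain g where "g \<in> H" "mono_dvd g a"
      unfolding mono_poly_in_ideal_gen_iff by blast
    moreover have "(mono_poly g :: ('n, 'k) mpoly) \<in> ideal_gen (mono_poly ` H)"
      unfolding mono_poly_in_ideal_gen_iff using \<open>g \<in> H\<close> mono_dvd_refl by blast
    ultimately show "a \<in> H"
      using \<open>a \<in> G0\<close> that by (auto simp: G0_def M_def)
  qed
  obtain G where G: "?gen G"
    using assms unfolding monomial_ideal_def by blast
  have "?gen G0"
  proof -
    have "(\<exists>g\<in>G. mono_dvd g a) \<longleftrightarrow> (\<exists>g\<in>G0. mono_dvd g a)" for a
    proof
      assume "\<exists>g\<in>G. mono_dvd g a"
      then have "a \<in> M"
        using G by (simp add: M_def mono_poly_in_ideal_gen_iff)
      then obtain m where "m \<in> M" "mono_dvd m a" "\<And>b. b \<in> M \<Longrightarrow> mono_dvd b m \<Longrightarrow> b = m"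
        by (rule exists_minimal_divisor) blast
      then show "\<exists>g\<in>G0. mono_dvd g a"
        unfolding G0_def by blast
    qed (use G0_least[OF G] in blast)
    with G show ?thesis
      by (simp add: ideal_gen_mono_poly)
  qed
  have "min_mono_gens I = G0"
    unfolding min_mono_gens_def
  proof (rule the_equality)
    show "?gen G0 \<and> (\<forall>H. H \<subset> G0 \<longrightarrow> \<not> ?gen H)"
      using \<open>?gen G0\<close> G0_least by blast
    show "H = G0" if "?gen H \<and> (\<forall>H'. H' \<subset> H \<longrightarrow> \<not> ?gen H')" for H
      using \<open>?gen G0\<close> G0_least that by blast
  qed
  with \<open>?gen G0\<close> show ?thesis
    by simp
qed

text \<open>The lcm is the pointwise maximum of exponents. The set A may be infinite; the common
  multiple u bounds the exponents, so the maxima exist.\<close>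

lemma exists_mono_lcm:
  fixes A :: "'n::finite mono set"
  assumes "A \<noteq> {}" and "\<And>a. a \<in> A \<Longrightarrow> mono_dvd a u"
  shows "\<exists>l. is_mono_lcm A l"
proof -
  define l where "l = Abs_poly_mapping (\<lambda>j. Max ((\<lambda>a. Poly_Mapping.lookup a j) ` A))"
  have fin: "finite ((\<lambda>a. Poly_Mapping.lookup a j) ` A)" for j
    by (rule finite_subset[of _ "{..Poly_Mapping.lookup u j}"])
      (use assms(2) in \<open>auto simp: mono_dvd_iff\<close>)
  have l: "Poly_Mapping.lookup l j = Max ((\<lambda>a. Poly_Mapping.lookup a j) ` A)" for j
    by (simp add: l_def)
  have "is_mono_lcm A l"
    using fin assms(1) by (auto simp: is_mono_lcm_def mono_dvd_iff l)
  then show ?thesis ..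
qed

text \<open>An element of Q dividing u is an lcm of generators that divide u too, so it divides the
  lcm t of all such generators. The second claim says that Q and the minimal generators have the
  same multiples: each element of Q is a multiple of a generator, and each multiple u of a generator
  has such a t in Q below it.\<close>

lemma
  fixes I :: "('n::finite, 'k::field) mpoly set"
  assumes "monomial_ideal I" and "I \<noteq> UNIV"
  defines "Q \<equiv> lcm_lattice I - {0}"
  shows lcm_lattice_top: "m \<in> Q \<Longrightarrow> mono_dvd m u \<Longrightarrow>
      \<exists>t\<in>Q. mono_dvd t u \<and> (\<forall>m\<in>Q. mono_dvd m u \<longrightarrow> mono_dvd m t)"
    and monomial_ideal_eq_lcm_multiples:
      "I = {p. \<forall>a\<in>Poly_Mapping.keys p. \<exists>m\<in>Q. mono_dvd m a}"
proof -
  define G where "G = min_mono_gens I"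
  have I: "I = {p. \<forall>a\<in>Poly_Mapping.keys p. \<exists>g\<in>G. mono_dvd g a}"
    using ideal_gen_min_mono_gens[OF assms(1)] by (simp add: G_def ideal_gen_mono_poly)
  have "0 \<notin> G"
  proof
    assume "0 \<in> G"
    then have "\<exists>g\<in>G. mono_dvd g a" for a
      by (intro bexI[of _ 0]) (auto simp: mono_dvd_iff)
    with assms(2) I show False
      by blast
  qed
  have Q_iff: "m \<in> Q \<longleftrightarrow> m \<noteq> 0 \<and> (\<exists>A\<subseteq>G. is_mono_lcm A m)" for m
    by (auto simp: Q_def lcm_lattice_def G_def)
  have divisor: "\<exists>g\<in>G. mono_dvd g m" if "m \<in> Q" for m
  proof -
    from that obtain A where A: "m \<noteq> 0" "A \<subseteq> G" "is_mono_lcm A m"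
      by (auto simp: Q_iff)
    \<comment> \<open>The lcm of the empty set is the monomial 1, which is excluded from Q.\<close>
    have "A \<noteq> {}"
    proof
      assume "A = {}"
      with A have "mono_dvd m 0"
        by (simp add: is_mono_lcm_def)
      with A show False
        by (simp add: mono_dvd_zero_iff)
    qed
    with A show ?thesis
      by (auto simp: is_mono_lcm_def)
  qed
  have top: "\<exists>t\<in>Q. mono_dvd t u \<and> (\<forall>m\<in>Q. mono_dvd m u \<longrightarrow> mono_dvd m t)"
    if g: "g \<in> G" "mono_dvd g u" for g u
  proof -
    obtain t where t: "is_mono_lcm {g \<in> G. mono_dvd g u} t"
      using exists_mono_lcm[of "{g \<in> G. mono_dvd g u}" u] g by blast
    have "t \<noteq> 0"
      using t g \<open>0 \<notin> G\<close> by (auto simp: is_mono_lcm_def mono_dvd_zero_iff)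
    then have "t \<in> Q"
      unfolding Q_iff using t by (intro conjI exI[of _ "{g \<in> G. mono_dvd g u}"]) auto
    moreover have "mono_dvd t u"
      using t by (auto simp: is_mono_lcm_def)
    moreover have "mono_dvd m t" if "m \<in> Q" "mono_dvd m u" for m
    proof -
      from that(1) obtain A where A: "A \<subseteq> G" "is_mono_lcm A m"
        by (auto simp: Q_iff)
      have "mono_dvd a t" if "a \<in> A" for a
        using A t that mono_dvd_trans[OF _ \<open>mono_dvd m u\<close>] by (auto simp: is_mono_lcm_def)
      with A(2) show ?thesis
        by (auto simp: is_mono_lcm_def)
    qed
    ultimately show ?thesis
      by blast
  qed
  show "\<exists>t\<in>Q. mono_dvd t u \<and> (\<forall>m\<in>Q. mono_dvd m u \<longrightarrow> mono_dvd m t)"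
    if "m \<in> Q" "mono_dvd m u"
    using divisor[OF that(1)] top mono_dvd_trans that(2) by blast
  have "(\<exists>g\<in>G. mono_dvd g a) \<longleftrightarrow> (\<exists>m\<in>Q. mono_dvd m a)" for a
    using top divisor mono_dvd_trans by blast
  with I show "I = {p. \<forall>a\<in>Poly_Mapping.keys p. \<exists>m\<in>Q. mono_dvd m a}"
    by simp
qed

lemma mono_poly_in_max_ideal:
  assumes "a \<noteq> 0"
  shows "(mono_poly a :: ('n, 'k::field) mpoly) \<in> max_ideal"
proof -
  obtain j where "Poly_Mapping.lookup a j \<noteq> 0"
    using assms by (metis lookup_zero poly_mapping_eqI)
  then have "mono_dvd (Poly_Mapping.single j 1) a"
    by (auto simp: mono_dvd_iff lookup_single when_def)
  then have "(mono_poly a :: ('n, 'k) mpoly) \<in> ideal_gen (mono_poly ` {Poly_Mapping.single j 1 | j. True})"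
    unfolding mono_poly_in_ideal_gen_iff by blast
  moreover have "mono_poly ` {Poly_Mapping.single j 1 | j. True}
      = {mono_poly (Poly_Mapping.single j 1) :: ('n, 'k) mpoly | j. True}"
    by auto
  ultimately show ?thesis
    by (simp only: max_ideal_def)
qed

section \<open>Complexes and bases\<close>

lemma linear_on_zero:
  assumes "linear_on s t A f" and "0 \<in> A"
  shows "f 0 = 0"
proof -
  have "f (0 + 0) = f 0 + f 0"
    using assms unfolding linear_on_def by blast
  then show ?thesis
    by simp
qed

text \<open>The ambient type carries no finiteness, so it is imported along an injection into
  functions supported on a finite set C: the image of a basis of W is independent and lies in the
  span of card C vectors.\<close>

lemma (in vector_space) finite_basis_of_embedding:
  fixes f :: "'b \<Rightarrow> ('x \<Rightarrow>\<^sub>0 'a)"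
  assumes "subspace V" and lin: "linear_on scale (\<lambda>c. Poly_Mapping.map ((*) c)) V f" and inj: "inj_on f V"
    and keys: "\<And>v. v \<in> V \<Longrightarrow> Poly_Mapping.keys (f v) \<subseteq> C" and "finite C"
    and "subspace W" and "W \<subseteq> V"
  shows "\<exists>B. finite B \<and> independent B \<and> span B = W"
proof -
  let ?t = "\<lambda>c. Poly_Mapping.map ((*) c) :: ('x \<Rightarrow>\<^sub>0 'a) \<Rightarrow> _"
  have lookup_t: "Poly_Mapping.lookup (?t c p) k = c * Poly_Mapping.lookup p k" for c p k
    by (simp add: Poly_Mapping.map.rep_eq when_def)
  interpret P: vector_space ?t
    by (unfold_locales; rule poly_mapping_eqI; simp add: lookup_t lookup_add distrib_left distrib_right)
  obtain B where B: "B \<subseteq> W" "independent B" "W \<subseteq> span B"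
    by (rule basis_exists[of W])
  have BV: "B \<subseteq> V"
    using B assms by blast
  have f_zero: "f 0 = 0"
    by (rule linear_on_zero[OF lin subspace_0[OF \<open>subspace V\<close>]])
  \<comment> \<open>Since f is linear on V only, the partial sums have to be kept inside V.\<close>
  have f_sum: "f (\<Sum>b\<in>T. scale (w b) b) = (\<Sum>b\<in>T. ?t (w b) (f b))" if "finite T" "T \<subseteq> B" for T w
    using that
  proof (induction T rule: finite_induct)
    case (insert b T)
    then have "b \<in> V" "scale (w b) b \<in> V" "(\<Sum>b\<in>T. scale (w b) b) \<in> V"
      using BV \<open>subspace V\<close> by (auto intro!: subspace_sum subspace_scale)
    then show ?case
      using insert lin by (simp add: linear_on_def)
  qed (simp add: f_zero)
  have "P.independent (f ` B)"
    unfolding P.independent_explicit_module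
  proof (intro allI impI)
    fix T w y
    assume T: "finite T" "T \<subseteq> f ` B" "(\<Sum>v\<in>T. ?t (w v) v) = 0" "y \<in> T"
    obtain T' where T': "T' \<subseteq> B" "finite T'" "T = f ` T'"
      using finite_subset_image[OF T(1,2)] by blast
    have "inj_on f T'"
      using inj T'(1) BV by (meson inj_on_subset)
    then have "f (\<Sum>b\<in>T'. scale (w (f b)) b) = f 0"
      using T T' by (simp add: f_sum f_zero sum.reindex)
    moreover have "(\<Sum>b\<in>T'. scale (w (f b)) b) \<in> V"
      using T' BV \<open>subspace V\<close> by (auto intro!: subspace_sum subspace_scale)
    ultimately have "(\<Sum>b\<in>T'. scale (w (f b)) b) = 0"
      using inj_onD[OF inj] subspace_0[OF \<open>subspace V\<close>] by blast
    then show "w y = 0"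
      using independentD[OF B(2) T'(2,1), of "\<lambda>b. w (f b)"] T(4) T'(3) by blast
  qed
  moreover have "f ` B \<subseteq> P.span ((\<lambda>x. Poly_Mapping.single x 1) ` C)"
  proof
    fix p
    assume "p \<in> f ` B"
    then have p: "Poly_Mapping.keys p \<subseteq> C"
      using keys BV by blast
    show "p \<in> P.span ((\<lambda>x. Poly_Mapping.single x 1) ` C)"
    proof (rule poly_mapping_sum_induct[where h = p])
      fix k
      assume "k \<in> Poly_Mapping.keys p"
      with p have "?t (Poly_Mapping.lookup p k) (Poly_Mapping.single k 1)
          \<in> P.span ((\<lambda>x. Poly_Mapping.single x 1) ` C)"
        by (intro P.span_scale P.span_base) auto
      then show "Poly_Mapping.single k (Poly_Mapping.lookup p k)
          \<in> P.span ((\<lambda>x. Poly_Mapping.single x 1) ` C)"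
        by simp
    qed (auto intro: P.span_zero P.span_add)
  qed
  ultimately have "finite (f ` B)"
    using P.independent_span_bound[OF finite_imageI[OF \<open>finite C\<close>]] by blast
  then have "finite B"
    by (rule finite_imageD) (rule inj_on_subset[OF inj BV])
  moreover have "span B = W"
    using B assms by (simp add: span_subspace)
  ultimately show ?thesis
    using B(2) by blast
qed

lemma finite_chains:
  assumes "finite P"
  shows "finite (chains P le k)"
  by (rule finite_subset[OF _ finite_lists_length_eq[OF assms, of "nat (k + 1)"]])
    (auto simp: chains_def)

text \<open>Padding with zeros lets all sums run over the same index set J, the form in which the
  differential of a synor-resolution takes a decomposition.\<close>

lemma family_sum_finite:
  assumes "finite J" and "\<And>x. x \<in> J \<Longrightarrow> 0 \<in> A x"
  shows "family_sum A J = {(\<Sum>x\<in>J. z x) | z. \<forall>x\<in>J. z x \<in> A x}"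
proof
  show "family_sum A J \<subseteq> {(\<Sum>x\<in>J. z x) | z. \<forall>x\<in>J. z x \<in> A x}"
  proof
    fix w
    assume "w \<in> family_sum A J"
    then obtain T f where T: "finite T" "T \<subseteq> J" "\<forall>x\<in>T. f x \<in> A x" "w = (\<Sum>x\<in>T. f x)"
      by (auto simp: family_sum_def)
    have "w = (\<Sum>x\<in>J. if x \<in> T then f x else 0)"
      using T assms(1) by (simp add: sum.If_cases Int_absorb1)
    then show "w \<in> {(\<Sum>x\<in>J. z x) | z. \<forall>x\<in>J. z x \<in> A x}"
      using T assms(2) by auto
  qed
qed (use assms(1) in \<open>auto simp: family_sum_def\<close>)

lemma family_sum_member:
  assumes "v \<in> A x" and "x \<in> J"
  shows "v \<in> family_sum A J"
  unfolding family_sum_def mem_Collect_eq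
  by (rule exI[of _ "{x}"], rule exI[of _ "\<lambda>_. v"]) (use assms in simp)

lemma linear_on_sum:
  assumes "linear_on s t A f" and "module.subspace s A" and "module s" and "\<And>i. i \<in> I \<Longrightarrow> g i \<in> A"
  shows "f (\<Sum>i\<in>I. g i) = (\<Sum>i\<in>I. f (g i))"
  using assms(4)
proof (induction I rule: infinite_finite_induct)
  case (insert i I)
  then have "g i \<in> A" "(\<Sum>i\<in>I. g i) \<in> A"
    by (auto intro: module.subspace_sum[OF assms(3,2)])
  with insert assms(1) show ?case
    by (simp add: linear_on_def)
qed (use linear_on_zero[OF assms(1)] module.subspace_0[OF assms(3,2)] in auto)

lemma order_complex_homology_of_top:
  fixes J :: "'p set" and le k
  defines "Y \<equiv> order_complex J le :: ('k::field, 'p list \<Rightarrow>\<^sub>0 'k, 'p) gcplx"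
  assumes "finite_poset J le" and "t \<in> J" and "\<And>x. x \<in> J \<Longrightarrow> le x t"
  shows "homology Y k \<subseteq> {boundaries Y k}"
proof (rule homology_subset_singleton)
  show "cycles Y k \<subseteq> boundaries Y k"
    unfolding Y_def by (rule order_complex_acyclic_of_top[OF assms(2-4)])
  show "0 \<in> boundaries Y k"
    by (auto simp: boundaries_def Y_def order_complex_def additive.zero[OF additive_chain_bnd]
        intro!: image_eqI[where x = 0])
  fix x y
  assume "x \<in> boundaries Y k" "y \<in> boundaries Y k"
  then obtain f g where fg: "x = chain_bnd f" "y = chain_bnd g"
    "Poly_Mapping.keys f \<subseteq> chains J le (k + 1)" "Poly_Mapping.keys g \<subseteq> chains J le (k + 1)"
    by (auto simp: boundaries_def Y_def order_complex_def)
  have "Poly_Mapping.keys (f - g) \<subseteq> Poly_Mapping.keys f \<union> Poly_Mapping.keys g"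
    by (auto simp: in_keys_iff lookup_minus)
  then show "x - y \<in> boundaries Y k"
    using fg by (auto simp: boundaries_def Y_def order_complex_def additive.diff[OF additive_chain_bnd]
        intro!: image_eqI[where x = "f - g"])
qed

section \<open>Synor-resolutions\<close>

text \<open>All that is used of the LCM-lattice is that 1 is left out and that the elements of Q
  dividing a given monomial, if there are any, have a largest one. The ideal returns only for the
  augmentation, as the polynomials whose terms are multiples of elements of Q.\<close>

locale synor_resolution_data =
  fixes Q :: "'n mono set"
    and X :: "('k::field, 'v::ab_group_add, 'n mono) gcplx"
    and \<phi> :: "int \<Rightarrow> 'v \<Rightarrow> ('n mono list \<Rightarrow>\<^sub>0 'k)"
    and R :: "(('n, 'k) mpoly, 'n mono \<times> 'n mono \<Rightarrow>\<^sub>0 'v, 'n mono) gcplx"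
  assumes synor: "synor_complex Q mono_dvd X \<phi>"
    and resolution: "synor_resolution_of Q X R"
    and zero_notin: "0 \<notin> Q"
    and top: "m \<in> Q \<Longrightarrow> mono_dvd m u \<Longrightarrow>
      \<exists>t\<in>Q. mono_dvd t u \<and> (\<forall>m\<in>Q. mono_dvd m u \<longrightarrow> mono_dvd m t)"
begin

section \<open>Unpacking the synor complex and its resolution\<close>

lemma poset: "finite_poset Q mono_dvd"
  and graded: "graded_complex Q mono_dvd X"
  and inj_phi: "inj_on (\<phi> i) (chn X i)"
  and chain_map: "graded_chain_map Q X (order_complex Q mono_dvd) \<phi>"
  using synor by (simp_all add: synor_complex_def strictly_graded_complex_def)

lemma strict:
  assumes "1 \<le> i" and "m \<in> Q"
  shows "bnd X i ` cmp X i m \<subseteq> family_sum (cmp X (i - 1)) (below Q mono_dvd m)"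
proof -
  have "\<forall>i\<ge>1. \<forall>m\<in>Q. bnd X i ` cmp X i m \<subseteq> family_sum (cmp X (i - 1)) (below Q mono_dvd m)"
    using synor unfolding synor_complex_def strictly_graded_complex_def by (elim conjE) assumption
  with assms show ?thesis
    by blast
qed

lemma homology_bij:
  assumes "order_ideal Q mono_dvd J"
  shows "bij_betw (homology_map (order_complex J mono_dvd :: ('k, 'n mono list \<Rightarrow>\<^sub>0 'k, 'n mono) gcplx) (\<phi> k) k)
      (homology (ideal_subcomplex X J) k)
      (homology (order_complex J mono_dvd :: ('k, 'n mono list \<Rightarrow>\<^sub>0 'k, 'n mono) gcplx) k)"
proof -
  have "\<forall>J. order_ideal Q mono_dvd J \<longrightarrow>
      (\<forall>k. bij_betw (homology_map (order_complex J mono_dvd :: ('k, 'n mono list \<Rightarrow>\<^sub>0 'k, 'n mono) gcplx) (\<phi> k) k)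
        (homology (ideal_subcomplex X J) k)
        (homology (order_complex J mono_dvd :: ('k, 'n mono list \<Rightarrow>\<^sub>0 'k, 'n mono) gcplx) k))"
    using synor unfolding synor_complex_def by (elim conjE) assumption
  with assms show ?thesis
    by blast
qed

lemma finite_Q: "finite Q"
  using poset by (simp add: finite_poset_def)

sublocale K: vector_space "smul X"
  using graded by (simp add: graded_complex_def is_complex_def module_iff_vector_space)

lemma complex_X: "is_complex X"
  using graded by (simp add: graded_complex_def)

lemma chn_subspace: "K.subspace (chn X i)"
  and bnd_linear: "linear_on (smul X) (smul X) (chn X i) (bnd X i)"
  and bnd_chn: "v \<in> chn X i \<Longrightarrow> bnd X i v \<in> chn X (i - 1)"
  and bnd_bnd: "v \<in> chn X i \<Longrightarrow> bnd X (i - 1) (bnd X i v) = 0"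
  using complex_X by (simp_all add: is_complex_def image_subset_iff)

lemma chn_neg: "i < -1 \<Longrightarrow> chn X i = {0}"
  and dim_chn_minus_one: "K.dim (chn X (-1)) = 1"
  and cmp_subspace: "0 \<le> i \<Longrightarrow> m \<in> Q \<Longrightarrow> K.subspace (cmp X i m)"
  and cmp_direct_sum: "0 \<le> i \<Longrightarrow> is_direct_sum (chn X i) (cmp X i) Q"
  using graded by (simp_all add: graded_complex_def)

lemma chn_eq_family_sum: "0 \<le> i \<Longrightarrow> chn X i = family_sum (cmp X i) Q"
  using cmp_direct_sum by (simp add: is_direct_sum_def)

lemma cmp_subset: "0 \<le> i \<Longrightarrow> m \<in> Q \<Longrightarrow> cmp X i m \<subseteq> chn X i"
  unfolding chn_eq_family_sum by (rule subsetI) (rule family_sum_member)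

abbreviation V :: "int \<Rightarrow> 'n mono \<Rightarrow> 'v set"
  where "V \<equiv> synor_coeffs Q X"

lemma V_subspace: "K.subspace (V i m)"
  by (auto simp: synor_coeffs_def chn_subspace cmp_subspace)

lemma V_subset: "V i m \<subseteq> chn X (i - 1)"
  using cmp_subset[of "i - 1" m] K.subspace_0[OF chn_subspace, of "i - 1"]
  by (simp add: synor_coeffs_def)

lemma V_nonzero: "v \<in> V i m \<Longrightarrow> v \<noteq> 0 \<Longrightarrow> i = 0 \<and> m = 0 \<or> 1 \<le> i \<and> m \<in> Q"
  by (auto simp: synor_coeffs_def split: if_splits)

lemma V_minus_one: "V 0 0 = chn X (-1)"
  by (simp add: synor_coeffs_def)

lemma V_cmp: "1 \<le> i \<Longrightarrow> m \<in> Q \<Longrightarrow> V i m = cmp X (i - 1) m"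
  by (simp add: synor_coeffs_def)

lemma smul_R: "smul R = poly_smul (smul X)"
  and chn_R: "chn R i = coeff_module (V i)"
  using resolution by (simp_all add: synor_resolution_of_def coeff_module_def)

lemma cmp_R: "cmp R i u = multidegree_part (V i) u"
proof -
  have "cmp R i u = {h \<in> chn R i. \<forall>(m, a)\<in>Poly_Mapping.keys h. m + a = u}"
    using resolution unfolding synor_resolution_of_def by blast
  then show ?thesis
    by (simp add: chn_R multidegree_part_def)
qed

lemma bnd_R_linear:
    "linear_on (poly_smul (smul X)) (poly_smul (smul X)) (coeff_module (V i)) (bnd R i)"
  and bnd_R: "h \<in> coeff_module (V i) \<Longrightarrow> bnd R i h \<in> coeff_module (V (i - 1))"
proof -
  have *: "linear_on (smul R) (smul R) (chn R i) (bnd R i)" "bnd R i ` chn R i \<subseteq> chn R (i - 1)"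
    using resolution unfolding synor_resolution_of_def by blast+
  show "linear_on (poly_smul (smul X)) (poly_smul (smul X)) (coeff_module (V i)) (bnd R i)"
    using *(1) by (simp only: smul_R chn_R)
  show "h \<in> coeff_module (V i) \<Longrightarrow> bnd R i h \<in> coeff_module (V (i - 1))"
    using *(2) by (auto simp only: chn_R)
qed

lemma bnd_R_one:
  assumes "m \<in> Q" and "\<zeta> \<in> cmp X 0 m"
  shows "bnd R 1 (Poly_Mapping.single (m, 0) \<zeta>) =
    poly_smul (smul X) (mono_poly m) (Poly_Mapping.single (0, 0) (bnd X 0 \<zeta>))"
proof -
  have "\<forall>m\<in>Q. \<forall>\<zeta>\<in>cmp X 0 m. bnd R 1 (Poly_Mapping.single (m, 0) \<zeta>) =
      smul R (mono_poly m) (Poly_Mapping.single (0, 0) (bnd X 0 \<zeta>))"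
    using resolution unfolding synor_resolution_of_def by blast
  with assms show ?thesis
    by (simp add: smul_R)
qed

lemma bnd_R_ge_2:
  assumes "2 \<le> i" "m \<in> Q" "\<zeta> \<in> cmp X (i - 1) m"
    and "\<And>m'. m' \<in> below Q mono_dvd m \<Longrightarrow> z m' \<in> cmp X (i - 2) m'"
    and "bnd X (i - 1) \<zeta> = (\<Sum>m'\<in>below Q mono_dvd m. z m')"
  shows "bnd R i (Poly_Mapping.single (m, 0) \<zeta>) =
        (\<Sum>m'\<in>below Q mono_dvd m.
          poly_smul (smul X) (mono_poly (m - m')) (Poly_Mapping.single (m', 0) (z m')))"
proof -
  have "\<forall>i\<ge>2. \<forall>m\<in>Q. \<forall>\<zeta>\<in>cmp X (i - 1) m. \<forall>z.
      (\<forall>m'\<in>below Q mono_dvd m. z m' \<in> cmp X (i - 2) m') \<and>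
      bnd X (i - 1) \<zeta> = (\<Sum>m'\<in>below Q mono_dvd m. z m') \<longrightarrow>
      bnd R i (Poly_Mapping.single (m, 0) \<zeta>) =
        (\<Sum>m'\<in>below Q mono_dvd m.
          smul R (mono_poly (m - m')) (Poly_Mapping.single (m', 0) (z m')))"
    using resolution unfolding synor_resolution_of_def by (elim conjE) assumption
  from this[rule_format, OF assms(1-3), of z] assms(4,5) show ?thesis
    unfolding smul_R by blast
qed

section \<open>The differential on the multigraded modules and its comparison with the synor
  complex\<close>

sublocale F: module "poly_smul (smul X) :: ('n, 'k) mpoly \<Rightarrow> _"
  by (rule K.module_poly_smul)

lemma coeff_module_neg: "i < 0 \<Longrightarrow> coeff_module (V i) = {0}"
  by (auto simp: coeff_module_def synor_coeffs_def poly_mapping_eq_iff fun_eq_iff)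

lemma bnd_R_add: "g \<in> coeff_module (V i) \<Longrightarrow> h \<in> coeff_module (V i) \<Longrightarrow>
    bnd R i (g + h) = bnd R i g + bnd R i h"
  and bnd_R_smul: "h \<in> coeff_module (V i) \<Longrightarrow>
    bnd R i (poly_smul (smul X) p h) = poly_smul (smul X) p (bnd R i h)"
  using bnd_R_linear[of i] unfolding linear_on_def by blast+

lemma bnd_R_zero: "bnd R i 0 = 0"
  by (rule linear_on_zero[OF bnd_R_linear]) (rule K.zero_in_coeff_module[OF V_subspace])

lemma bnd_zero: "bnd X i 0 = 0"
  by (rule linear_on_zero[OF bnd_linear]) (rule K.subspace_0[OF chn_subspace])

lemma finite_below: "finite (below Q mono_dvd m)"
  using finite_Q by (simp add: below_def)

lemmas zero_in_F = K.zero_in_coeff_module[of "V i", OF V_subspace] for i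
lemmas add_in_F = K.add_in_coeff_module[of "V i", OF V_subspace] for i
lemmas single_in_F = K.single_in_coeff_module[of "V i", OF V_subspace] for i
lemmas F_induct [consumes 1, case_names zero add single] =
  K.coeff_module_induct[of "V i", OF V_subspace] for i
lemmas zero_in_part = K.zero_in_multidegree_part[of "V i", OF V_subspace] for i
lemmas add_in_part = K.add_in_multidegree_part[of "V i", OF V_subspace] for i
lemmas diff_in_part = K.diff_in_multidegree_part[of "V i", OF V_subspace] for i
lemmas sum_in_part = K.sum_in_multidegree_part[of "V i", OF V_subspace] for i
lemmas single_in_part = K.single_in_multidegree_part[of "V i", OF V_subspace] for i
lemmas part_induct [consumes 1, case_names zero add single] =
  K.multidegree_part_induct[of "V i", OF V_subspace] for i

text \<open>One formula for both clauses of the differential: the terms z m' \<otimes> x^(a + (m -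
  m')) come from a decomposition of the boundary of \<open>\<zeta>\<close> into components with m'
  strictly below m. All later arguments about \<open>bnd R\<close> rest on it.\<close>

lemma bnd_single:
  assumes "1 \<le> i" and "\<zeta> \<in> V i m"
  obtains M z where "finite M" "\<And>m'. m' \<in> M \<Longrightarrow> z m' \<in> V (i - 1) m' \<and> mono_dvd m' m \<and> m' \<noteq> m"
    "bnd X (i - 1) \<zeta> = (\<Sum>m'\<in>M. z m')"
    "\<And>a. bnd R i (Poly_Mapping.single (m, a) \<zeta>)
      = (\<Sum>m'\<in>M. Poly_Mapping.single (m', a + (m - m')) (z m'))"
proof (cases "\<zeta> = 0")
  case True
  then show thesis
    by (intro that[of "{}" "\<lambda>_. 0"]) (auto simp: bnd_zero bnd_R_zero)
next
  case False
  with assms V_nonzero have m: "m \<in> Q"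
    by force
  have \<zeta>: "\<zeta> \<in> cmp X (i - 1) m"
    using assms m by (simp add: V_cmp)
  \<comment> \<open>The differential is prescribed at exponent 0 only; S-linearity moves the formula
    to x^a.\<close>
  have shift: "bnd R i (Poly_Mapping.single (m, a) \<zeta>)
      = (\<Sum>m'\<in>M. Poly_Mapping.single (m', a + (m - m')) (z m'))"
    if "bnd R i (Poly_Mapping.single (m, 0) \<zeta>)
      = (\<Sum>m'\<in>M. poly_smul (smul X) (mono_poly (m - m')) (Poly_Mapping.single (m', 0) (z m')))"
    for M z a
  proof -
    have "Poly_Mapping.single (m, a) \<zeta>
        = poly_smul (smul X) (mono_poly a) (Poly_Mapping.single (m, 0) \<zeta>)"
      by (simp add: mono_poly_def K.poly_smul_single_single)
    then have "bnd R i (Poly_Mapping.single (m, a) \<zeta>)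
        = poly_smul (smul X) (mono_poly a) (bnd R i (Poly_Mapping.single (m, 0) \<zeta>))"
      using assms(2) by (simp add: bnd_R_smul single_in_F)
    also have "\<dots> = (\<Sum>m'\<in>M. Poly_Mapping.single (m', a + (m - m')) (z m'))"
      unfolding that additive.sum[OF K.additive_poly_smul_right]
      by (simp add: mono_poly_def K.poly_smul_single_single)
    finally show ?thesis .
  qed
  show thesis
  proof (cases "i = 1")
    case True
    \<comment> \<open>In degree 1 the only target index is the monomial 1, the exponent vector 0. It
      differs from m because 1 is not in Q.\<close>
    have "bnd X 0 \<zeta> \<in> V 0 0"
      using bnd_chn[of \<zeta> 0] \<zeta> cmp_subset[of 0 m] m True by (auto simp: V_minus_one)
    then show thesis
      using m \<zeta> True zero_notin
      by (intro that[of "{0}" "\<lambda>_. bnd X 0 \<zeta>"] shift) (auto simp: bnd_R_one mono_dvd_iff)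
  next
    case False
    with assms have i: "2 \<le> i"
      by simp
    have "bnd X (i - 1) \<zeta> \<in> family_sum (cmp X (i - 2)) (below Q mono_dvd m)"
      using strict[of "i - 1" m] i m \<zeta> by auto
    moreover have "0 \<in> cmp X (i - 2) m'" if "m' \<in> below Q mono_dvd m" for m'
      using that i by (intro K.subspace_0[OF cmp_subspace]) (auto simp: below_def)
    \<comment> \<open>The clause for the differential holds for every decomposition of the boundary;
      strictness of the grading supplies one.\<close>
    ultimately obtain z where z: "\<And>m'. m' \<in> below Q mono_dvd m \<Longrightarrow> z m' \<in> cmp X (i - 2) m'"
      "bnd X (i - 1) \<zeta> = (\<Sum>m'\<in>below Q mono_dvd m. z m')"
      by (auto simp: family_sum_finite[OF finite_below])
    have "z m' \<in> V (i - 1) m' \<and> mono_dvd m' m \<and> m' \<noteq> m" if "m' \<in> below Q mono_dvd m" for m'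
      using z(1)[OF that] that i V_cmp[of "i - 1" m'] by (auto simp: below_def)
    then show thesis
      using z bnd_R_ge_2[OF i m \<zeta> z] by (intro that[OF finite_below] shift) auto
  qed
qed

lemma bnd_R_multidegree:
  assumes "1 \<le> i" and "h \<in> multidegree_part (V i) u"
  shows "bnd R i h \<in> multidegree_part (V (i - 1)) u"
  using assms(2)
proof (induction h rule: part_induct)
  case zero
  show ?case
    by (simp add: bnd_R_zero zero_in_part)
next
  case (add f g)
  then show ?case
    by (auto simp: bnd_R_add multidegree_partD intro: add_in_part)
next
  case (single m a v)
  obtain M z where "\<And>m'. m' \<in> M \<Longrightarrow> z m' \<in> V (i - 1) m' \<and> mono_dvd m' m \<and> m' \<noteq> m"
    "\<And>a. bnd R i (Poly_Mapping.single (m, a) v)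
      = (\<Sum>m'\<in>M. Poly_Mapping.single (m', a + (m - m')) (z m'))"
    by (rule bnd_single[OF assms(1) single(1)]) blast
  moreover have "m' + (a + (m - m')) = u" if "mono_dvd m' m" for m'
    using mono_dvd_add_diff[OF that] single(2) by (simp add: add.left_commute add.commute)
  ultimately show ?case
    by (auto intro!: sum_in_part single_in_part)
qed

lemma coeff_sum_chn: "h \<in> coeff_module (V i) \<Longrightarrow> coeff_sum h \<in> chn X (i - 1)"
  by (induction h rule: F_induct)
    (use V_subset in \<open>auto simp: additive.zero[OF additive_coeff_sum] additive.add[OF additive_coeff_sum]
      intro: K.subspace_0[OF chn_subspace] K.subspace_add[OF chn_subspace]\<close>)

text \<open>The factors m/m' become 1, which leaves the decomposition of the synor boundary. Thus
  \<open>coeff_sum\<close> is a chain map from F_i to degree i - 1.\<close>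

lemma coeff_sum_bnd_R:
  assumes "1 \<le> i" and "h \<in> coeff_module (V i)"
  shows "coeff_sum (bnd R i h) = bnd X (i - 1) (coeff_sum h)"
  using assms(2)
proof (induction h rule: F_induct)
  case zero
  show ?case
    by (simp add: bnd_R_zero bnd_zero additive.zero[OF additive_coeff_sum])
next
  case (add f g)
  then have "bnd X (i - 1) (coeff_sum f + coeff_sum g)
      = bnd X (i - 1) (coeff_sum f) + bnd X (i - 1) (coeff_sum g)"
    using bnd_linear[of "i - 1"] coeff_sum_chn unfolding linear_on_def by blast
  with add show ?case
    by (simp add: bnd_R_add additive.add[OF additive_coeff_sum])
next
  case (single m a v)
  obtain M z where "bnd X (i - 1) v = (\<Sum>m'\<in>M. z m')"
    "\<And>a. bnd R i (Poly_Mapping.single (m, a) v)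
      = (\<Sum>m'\<in>M. Poly_Mapping.single (m', a + (m - m')) (z m'))"
    by (rule bnd_single[OF assms(1) single(1)]) blast
  then show ?case
    by (simp add: additive.sum[OF additive_coeff_sum])
qed

text \<open>In multidegree u distinct keys have distinct indices, so the coefficients lie in
  distinct components, and a vanishing sum forces each to vanish by directness. In degree 0 there is
  just the index 0.\<close>

lemma coeff_sum_eq_zero:
  assumes h: "h \<in> multidegree_part (V i) u" and "coeff_sum h = 0"
  shows "h = 0"
proof -
  have keys: "k \<in> Poly_Mapping.keys h \<Longrightarrow> Poly_Mapping.lookup h k \<in> V i (fst k)"
    "k \<in> Poly_Mapping.keys h \<Longrightarrow> Poly_Mapping.lookup h k \<noteq> 0"
    "k \<in> Poly_Mapping.keys h \<Longrightarrow> fst k + snd k = u" for k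
    using h by (auto simp: multidegree_part_def coeff_module_def in_keys_iff) (cases k; simp)
  have inj: "inj_on fst (Poly_Mapping.keys h)"
    using keys(3) by (auto intro!: inj_onI prod_eqI) (metis add_left_cancel)
  \<comment> \<open>If m is the index of a key of h, then m divides u and u - m recovers the
    exponent.\<close>
  define f where "f m = Poly_Mapping.lookup h (m, u - m)" for m
  have f: "Poly_Mapping.lookup h k = f (fst k)" if "k \<in> Poly_Mapping.keys h" for k
    using keys(3)[OF that] by (cases k) (auto simp: f_def)
  have sum: "(\<Sum>m\<in>fst ` Poly_Mapping.keys h. f m) = 0"
    using assms(2) f by (simp add: sum.reindex[OF inj] coeff_sum_def keys_sum_def)
  have "\<forall>m\<in>fst ` Poly_Mapping.keys h. f m = 0"
  proof (cases "i = 0")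
    case True
    then have "fst ` Poly_Mapping.keys h \<subseteq> {0}"
      using keys V_nonzero by fastforce
    then have "fst ` Poly_Mapping.keys h = {} \<or> fst ` Poly_Mapping.keys h = {0}"
      by (rule subset_singletonD)
    then show ?thesis
      using sum by (elim disjE) simp_all
  next
    case False
    have i: "1 \<le> i \<and> m \<in> Q \<and> f m \<in> cmp X (i - 1) m" if "m \<in> fst ` Poly_Mapping.keys h" for m
    proof -
      from that obtain k where k: "k \<in> Poly_Mapping.keys h" "m = fst k"
        by blast
      then have "f m \<in> V i m" "f m \<noteq> 0"
        using keys(1,2)[OF k(1)] f[OF k(1)] by simp_all
      then show ?thesis
        using V_nonzero[of "f m" i m] False V_cmp[of i m] by simp
    qed
    show ?thesis
    proof (cases "1 \<le> i")
      case True
      then have "is_direct_sum (chn X (i - 1)) (cmp X (i - 1)) Q"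
        by (intro cmp_direct_sum) simp
      then show ?thesis
        unfolding is_direct_sum_def
        by (elim conjE allE[of _ "fst ` Poly_Mapping.keys h"] allE[of _ f] mp) (use sum i in auto)
    qed (use i in blast)
  qed
  then have "k \<notin> Poly_Mapping.keys h" for k
    using f[of k] keys(2)[of k] by auto
  then show ?thesis
    by (intro poly_mapping_eqI) (simp add: in_keys_iff)
qed

lemma coeff_sum_inj:
  assumes "g \<in> multidegree_part (V i) u" "h \<in> multidegree_part (V i) u" "coeff_sum g = coeff_sum h"
  shows "g = h"
  using coeff_sum_eq_zero[OF diff_in_part[OF assms(1,2)]] assms(3)
  by (simp add: additive.diff[OF additive_coeff_sum])

text \<open>A consequence of the same identity in the synor complex: on a homogeneous term the
  double differential is homogeneous with coefficient sum 0. For i \<le> 1 it lands in a zero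
  module.\<close>

lemma bnd_R_bnd_R:
  assumes "h \<in> coeff_module (V i)"
  shows "bnd R (i - 1) (bnd R i h) = 0"
proof (cases "2 \<le> i")
  case False
  then show ?thesis
    using bnd_R[OF bnd_R[OF assms]] coeff_module_neg[of "i - 1 - 1"] by auto
next
  case True
  from assms show ?thesis
  proof (induction h rule: F_induct)
    case zero
    show ?case
      by (simp add: bnd_R_zero)
  next
    case (add f g)
    then show ?case
      by (simp add: bnd_R_add bnd_R)
  next
    case (single m a v)
    define h where "h = Poly_Mapping.single (m, a) v"
    have h: "h \<in> multidegree_part (V i) (m + a)" "h \<in> coeff_module (V i)"
      using single by (auto simp: h_def intro: single_in_part
          single_in_F)
    have "bnd R (i - 1) (bnd R i h) \<in> multidegree_part (V (i - 1 - 1)) (m + a)"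
      using True h by (intro bnd_R_multidegree) auto
    moreover have "coeff_sum (bnd R (i - 1) (bnd R i h)) = bnd X (i - 1 - 1) (bnd X (i - 1) (coeff_sum h))"
      using True h by (simp add: coeff_sum_bnd_R bnd_R)
    then have "coeff_sum (bnd R (i - 1) (bnd R i h)) = 0"
      using bnd_bnd[OF coeff_sum_chn[OF h(2)]] by simp
    ultimately show ?case
      unfolding h_def[symmetric] by (rule coeff_sum_eq_zero)
  qed
qed

section \<open>Exactness of the strand in a fixed multidegree\<close>

definition divisors :: "'n mono \<Rightarrow> 'n mono set"
  where "divisors u = {m \<in> Q. mono_dvd m u}"

text \<open>The top element of the order ideal makes its order complex acyclic, and injectivity in
  (S2) transfers this to the synor complex. The degree k = -1 is included; it yields exactness of
  the strand at F_0.\<close>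

lemma divisors_acyclic:
  assumes "divisors u \<noteq> {}"
  shows "cycles (ideal_subcomplex X (divisors u)) k \<subseteq> boundaries (ideal_subcomplex X (divisors u)) k"
proof -
  let ?O = "order_complex (divisors u) mono_dvd :: ('k, 'n mono list \<Rightarrow>\<^sub>0 'k, 'n mono) gcplx"
  let ?S = "ideal_subcomplex X (divisors u)"
  obtain m where "m \<in> Q" "mono_dvd m u"
    using assms by (auto simp: divisors_def)
  from top[OF this] obtain t where t: "t \<in> divisors u" "\<And>m. m \<in> divisors u \<Longrightarrow> mono_dvd m t"
    by (auto simp: divisors_def)
  have "finite_poset (divisors u) mono_dvd"
    using finite_Q mono_dvd_refl mono_dvd_antisym mono_dvd_trans
    unfolding finite_poset_def divisors_def by (intro conjI ballI impI) (simp, blast+)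
  then have "homology ?O k \<subseteq> {boundaries ?O k}"
    using t by (rule order_complex_homology_of_top)
  moreover have "order_ideal Q mono_dvd (divisors u)"
    unfolding order_ideal_def divisors_def using mono_dvd_trans by blast
  then have bij: "bij_betw (homology_map ?O (\<phi> k) k) (homology ?S k) (homology ?O k)"
    by (rule homology_bij)
  ultimately have "homology_map ?O (\<phi> k) k ` homology ?S k \<subseteq> {boundaries ?O k}"
    by (simp add: bij_betw_def)
  moreover have zero: "0 \<in> chn ?S i" for i
    using K.subspace_0[OF chn_subspace]
    by (auto simp: ideal_subcomplex_def family_sum_def intro!: exI[of _ "{}"])
  then have "0 \<in> cycles ?S k"
    by (simp add: cycles_def) (simp add: ideal_subcomplex_def bnd_zero)
  moreover have "0 \<in> boundaries ?S k"
    using zero[of "k + 1"] unfolding boundaries_def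
    by (rule image_eqI[rotated]) (simp add: ideal_subcomplex_def bnd_zero)
  ultimately show ?thesis
    by (rule boundaries_of_homology_inj[OF bij_betw_imp_inj_on[OF bij]])
qed

lemma zero_in_cmp: "0 \<le> i \<Longrightarrow> m \<in> divisors u \<Longrightarrow> 0 \<in> cmp X i m"
  by (auto simp: divisors_def intro: K.subspace_0[OF cmp_subspace])

lemma finite_divisors: "finite (divisors u)"
  using finite_Q by (simp add: divisors_def)

lemma family_sum_divisors:
  "0 \<le> i \<Longrightarrow> family_sum (cmp X i) (divisors u)
    = {(\<Sum>m\<in>divisors u. z m) | z. \<forall>m\<in>divisors u. z m \<in> cmp X i m}"
  by (rule family_sum_finite[OF finite_divisors zero_in_cmp])

lemma family_sum_divisors_add:
  assumes "0 \<le> i" "v \<in> family_sum (cmp X i) (divisors u)" "w \<in> family_sum (cmp X i) (divisors u)"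
  shows "v + w \<in> family_sum (cmp X i) (divisors u)"
proof -
  obtain y z where y: "\<forall>m\<in>divisors u. y m \<in> cmp X i m" "v = (\<Sum>m\<in>divisors u. y m)"
    and z: "\<forall>m\<in>divisors u. z m \<in> cmp X i m" "w = (\<Sum>m\<in>divisors u. z m)"
    using assms(2,3) unfolding family_sum_divisors[OF assms(1)] by auto
  have "\<forall>m\<in>divisors u. y m + z m \<in> cmp X i m"
    using y z cmp_subspace[OF assms(1)] by (auto simp: divisors_def intro!: K.subspace_add)
  then show ?thesis
    unfolding family_sum_divisors[OF assms(1)] mem_Collect_eq y(2) z(2) sum.distrib[symmetric]
    by blast
qed

text \<open>A term with index m and multidegree u = m + a has m dividing u. In degree 0 nothing is
  restricted, as every ideal subcomplex contains all of degree -1.\<close>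

lemma coeff_sum_in_ideal_subcomplex:
  assumes "0 \<le> i" and "h \<in> multidegree_part (V i) u"
  shows "coeff_sum h \<in> chn (ideal_subcomplex X (divisors u)) (i - 1)"
proof (cases "i = 0")
  case True
  then show ?thesis
    using coeff_sum_chn[OF multidegree_partD[OF assms(2)]] by (simp add: ideal_subcomplex_def)
next
  case False
  with assms(1) have i: "1 \<le> i"
    by simp
  have "coeff_sum h \<in> family_sum (cmp X (i - 1)) (divisors u)"
    using assms(2)
  proof (induction h rule: part_induct)
    case zero
    then show ?case
      by (auto simp: additive.zero[OF additive_coeff_sum] family_sum_def intro!: exI[of _ "{}"])
  next
    case (add f g)
    then show ?case
      using i by (simp add: additive.add[OF additive_coeff_sum] family_sum_divisors_add)
  next
    case (single m a v)
    show ?case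
    proof (cases "v = 0")
      case True
      then show ?thesis
        by (auto simp: additive.zero[OF additive_coeff_sum] family_sum_def intro!: exI[of _ "{}"])
    next
      case False
      with single i V_nonzero have "m \<in> Q"
        by force
      moreover have "mono_dvd m u"
        using single(2) unfolding mono_dvd_def by blast
      ultimately show ?thesis
        using single i by (auto simp: V_cmp divisors_def intro!: family_sum_member)
    qed
  qed
  then show ?thesis
    using i by (simp add: ideal_subcomplex_def)
qed

text \<open>Homogenization: the component of w at m is multiplied by x^(u - m), so that every term
  reaches multidegree u.\<close>

lemma coeff_sum_surj:
  assumes "1 \<le> i" and "w \<in> chn (ideal_subcomplex X (divisors u)) (i - 1)"
  obtains g where "g \<in> multidegree_part (V i) u" "coeff_sum g = w"
proof -
  have i: "0 \<le> i - 1"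
    using assms(1) by simp
  have "w \<in> family_sum (cmp X (i - 1)) (divisors u)"
    using assms by (simp add: ideal_subcomplex_def)
  then obtain z where z: "\<And>m. m \<in> divisors u \<Longrightarrow> z m \<in> cmp X (i - 1) m" "w = (\<Sum>m\<in>divisors u. z m)"
    unfolding family_sum_divisors[OF i] by auto
  have "(\<Sum>m\<in>divisors u. Poly_Mapping.single (m, u - m) (z m)) \<in> multidegree_part (V i) u"
    using z(1) assms(1) V_cmp mono_dvd_add_diff
    by (intro sum_in_part single_in_part)
      (auto simp: divisors_def)
  then show thesis
    by (rule that) (simp add: additive.sum[OF additive_coeff_sum] z(2))
qed

text \<open>The coefficient sum of h is a cycle, hence the boundary of some w. The homogenization g
  of w satisfies \<open>bnd R (i + 1) g = h\<close>, because both sides have multidegree u and the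
  same coefficient sum.\<close>

lemma multidegree_exact:
  assumes "0 \<le> i" and "divisors u \<noteq> {}"
    and h: "h \<in> multidegree_part (V i) u" and "bnd R i h = 0"
  shows "h \<in> bnd R (i + 1) ` coeff_module (V (i + 1))"
proof -
  have h': "h \<in> coeff_module (V i)"
    using h by (rule multidegree_partD)
  have "bnd X (i - 1) (coeff_sum h) = 0"
  proof (cases "i = 0")
    \<comment> \<open>For i = 0 the boundary lands in degree -2 of the synor complex, which is
      zero.\<close>
    case True
    then show ?thesis
      using bnd_chn[OF coeff_sum_chn[OF h']] chn_neg[of "-2"] by simp
  next
    case False
    then show ?thesis
      using coeff_sum_bnd_R[of i h] h' assms by (simp add: additive.zero[OF additive_coeff_sum])
  qed
  then have "coeff_sum h \<in> cycles (ideal_subcomplex X (divisors u)) (i - 1)"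
    using coeff_sum_in_ideal_subcomplex[OF assms(1) h] by (simp add: cycles_def) (simp add: ideal_subcomplex_def)
  then have "coeff_sum h \<in> boundaries (ideal_subcomplex X (divisors u)) (i - 1)"
    using divisors_acyclic[OF assms(2)] by blast
  then obtain w where w: "w \<in> chn (ideal_subcomplex X (divisors u)) (i + 1 - 1)" "coeff_sum h = bnd X i w"
    by (auto simp: boundaries_def) (auto simp: ideal_subcomplex_def)
  obtain g where g: "g \<in> multidegree_part (V (i + 1)) u" "coeff_sum g = w"
    by (rule coeff_sum_surj[OF _ w(1)]) (use assms(1) in auto)
  then have g': "g \<in> coeff_module (V (i + 1))"
    by (simp add: multidegree_partD)
  have "bnd R (i + 1) g = h"
  proof (rule coeff_sum_inj[OF _ h])
    show "bnd R (i + 1) g \<in> multidegree_part (V i) u"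
      using bnd_R_multidegree[of "i + 1" g u] g assms(1) by simp
    show "coeff_sum (bnd R (i + 1) g) = coeff_sum h"
      using coeff_sum_bnd_R[of "i + 1" g] g g' w assms(1) by simp
  qed
  with g' show ?thesis
    by blast
qed

section \<open>Freeness and finite rank\<close>

lemma V_finite_basis: "\<exists>B. finite B \<and> K.independent B \<and> K.span B = V i m"
proof (cases "V i m = {0}")
  case True
  then show ?thesis
    by (intro exI[of _ "{}"]) (simp add: K.independent_empty)
next
  case False
  have lin: "linear_on (smul X) (\<lambda>c. Poly_Mapping.map ((*) c)) (chn X (i - 1)) (\<phi> (i - 1))"
    and range: "\<phi> (i - 1) ` chn X (i - 1) \<subseteq> {f. Poly_Mapping.keys f \<subseteq> chains Q mono_dvd (i - 1)}"
    using chain_map by (simp_all add: graded_chain_map_def order_complex_def)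
  show ?thesis
    by (rule K.finite_basis_of_embedding[OF chn_subspace lin inj_phi _ finite_chains[OF finite_Q]
          V_subspace V_subset]) (use range in auto)
qed

lemma complex_R: "is_complex R"
  unfolding is_complex_def smul_R chn_R
proof (intro conjI allI ballI)
  show "module (poly_smul (smul X) :: ('n, 'k) mpoly \<Rightarrow> _)"
    by (rule F.module_axioms)
  show "F.subspace (coeff_module (V i))" for i
    by (rule K.subspace_coeff_module[OF V_subspace])
  show "linear_on (poly_smul (smul X)) (poly_smul (smul X)) (coeff_module (V i)) (bnd R i)" for i
    by (rule bnd_R_linear)
  show "bnd R i ` coeff_module (V i) \<subseteq> coeff_module (V (i - 1))" for i
    by (rule image_subsetI) (rule bnd_R)
  show "bnd R (i - 1) (bnd R i h) = 0" if "h \<in> coeff_module (V i)" for i h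
    using that by (rule bnd_R_bnd_R)
qed

text \<open>Bases are chosen for all monomials m at once; they are empty outside Q and the extra
  index 0, which carries F_0.\<close>

lemma finite_homogeneous_basis:
  "\<exists>E. finite E \<and> E \<subseteq> (\<Union>u. multidegree_part (V i) u)
    \<and> free_basis (poly_smul (smul X)) (coeff_module (V i)) E"
proof -
  obtain Bs where Bs: "\<And>m. finite (Bs m)" "\<And>m. K.independent (Bs m)" "\<And>m. K.span (Bs m) = V i m"
    using V_finite_basis[of i] by metis
  have empty: "Bs m = {}" if "m \<notin> insert 0 Q" for m
  proof -
    have "V i m = {0}"
      using that by (simp add: synor_coeffs_def)
    then have "Bs m \<subseteq> {0}"
      using Bs(3)[of m] K.span_superset[of "Bs m"] by simp
    then show ?thesis
      using Bs(2)[of m] K.dependent_zero[of "Bs m"] by (auto dest: subset_singletonD)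
  qed
  let ?E = "\<Union>m\<in>insert 0 Q. Poly_Mapping.single (m, 0 :: 'n mono) ` Bs m"
  have "finite ?E"
    using finite_Q Bs(1) by blast
  moreover have "?E \<subseteq> (\<Union>u. multidegree_part (V i) u)"
  proof
    fix e
    assume "e \<in> ?E"
    then obtain m b where "b \<in> Bs m" "e = Poly_Mapping.single (m, 0 :: 'n mono) b"
      by blast
    then have "e \<in> multidegree_part (V i) m"
      using Bs(3)[of m] K.span_base[of b "Bs m"] by (simp add: single_in_part)
    then show "e \<in> (\<Union>u. multidegree_part (V i) u)"
      by blast
  qed
  moreover have "free_basis (poly_smul (smul X)) (coeff_module (V i)) ?E"
    by (rule K.free_basis_coeff_module[OF V_subspace _ empty Bs(2,3)]) (use finite_Q in auto)
  ultimately show ?thesis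
    by blast
qed

lemma multigraded_free: "multigraded_free_complex R"
  unfolding multigraded_free_complex_def
proof (intro conjI allI impI)
  show "is_complex R"
    by (rule complex_R)
  show "chn R i = {0}" if "i < 0" for i
    using that by (simp add: chn_R coeff_module_neg)
  show "module.subspace (\<lambda>c. smul R (Poly_Mapping.single 0 c)) (cmp R i u)" for i u
    unfolding smul_R cmp_R by (rule K.subspace_multidegree_part[OF V_subspace])
  show "is_direct_sum (chn R i) (cmp R i) UNIV" for i
    unfolding chn_R cmp_R by (rule K.coeff_module_direct_sum[OF V_subspace])
  show "smul R (Poly_Mapping.single a c) ` cmp R i u \<subseteq> cmp R i (u + a)" for i u a c
    unfolding smul_R cmp_R
    by (rule image_subsetI) (rule K.poly_smul_single_in_multidegree_part[OF V_subspace])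
  show "bnd R i ` cmp R i u \<subseteq> cmp R (i - 1) u" for i u
  proof (cases "1 \<le> i")
    case True
    then show ?thesis
      unfolding cmp_R by (intro image_subsetI bnd_R_multidegree)
  next
    case False
    then have "bnd R i h = 0" if "h \<in> multidegree_part (V i) u" for h
      using bnd_R[OF multidegree_partD[OF that]] coeff_module_neg[of "i - 1"] by simp
    then show ?thesis
      unfolding cmp_R by (auto intro: zero_in_part)
  qed
  show "\<exists>E. finite E \<and> E \<subseteq> (\<Union>u. cmp R i u) \<and> free_basis (smul R) (chn R i) E" for i
    unfolding smul_R cmp_R chn_R by (rule finite_homogeneous_basis)
qed

section \<open>Exactness in positive homological degrees\<close>

lemma boundaries_R: "boundaries R i = bnd R (i + 1) ` coeff_module (V (i + 1))"
  by (simp add: boundaries_def chn_R)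

lemma boundaries_add:
  assumes "g \<in> boundaries R i" "h \<in> boundaries R i"
  shows "g + h \<in> boundaries R i"
proof -
  obtain g' h' where "g' \<in> coeff_module (V (i + 1))" "h' \<in> coeff_module (V (i + 1))"
    "g = bnd R (i + 1) g'" "h = bnd R (i + 1) h'"
    using assms by (auto simp: boundaries_R)
  then show ?thesis
    unfolding boundaries_R by (intro image_eqI[where x = "g' + h'"]) (simp_all add: bnd_R_add add_in_F)
qed

lemma zero_in_boundaries: "0 \<in> boundaries R i"
  unfolding boundaries_R by (intro image_eqI[where x = 0]) (simp_all add: bnd_R_zero zero_in_F)

lemma boundaries_sum:
  assumes "\<And>j. j \<in> A \<Longrightarrow> f j \<in> boundaries R i"
  shows "(\<Sum>j\<in>A. f j) \<in> boundaries R i"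
  using assms
  by (induction A rule: infinite_finite_induct) (auto intro: zero_in_boundaries boundaries_add)

text \<open>The differential preserves multidegrees, so by directness every homogeneous part of a
  cycle is itself a cycle, and exactness can be tested on strands.\<close>

lemma exact:
  assumes "1 \<le> i"
  shows "cycles R i = boundaries R i"
proof
  show "boundaries R i \<subseteq> cycles R i"
    using bnd_R[of _ "i + 1"] bnd_R_bnd_R[of _ "i + 1"] by (auto simp: boundaries_R cycles_def chn_R)
next
  show "cycles R i \<subseteq> boundaries R i"
  proof
    fix h
    assume "h \<in> cycles R i"
    then have h: "h \<in> coeff_module (V i)" "bnd R i h = 0"
      by (simp_all add: cycles_def chn_R)
    have "h \<in> family_sum (multidegree_part (V i)) UNIV"
      using h(1) K.coeff_module_direct_sum[of "V i", OF V_subspace] by (simp add: is_direct_sum_def)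
    then obtain T f where T: "finite T" "\<forall>u\<in>T. f u \<in> multidegree_part (V i) u" "h = (\<Sum>u\<in>T. f u)"
      unfolding family_sum_def by blast
    have "bnd R i (\<Sum>u\<in>T. f u) = (\<Sum>u\<in>T. bnd R i (f u))"
      by (rule linear_on_sum[OF bnd_R_linear K.subspace_coeff_module[OF V_subspace] F.module_axioms])
        (rule multidegree_partD[OF bspec[OF T(2)]])
    then have sum: "(\<Sum>u\<in>T. bnd R i (f u)) = 0"
      using h(2) T(3) by simp
    have part: "bnd R i (f u) \<in> multidegree_part (V (i - 1)) u" if "u \<in> T" for u
      using bnd_R_multidegree[OF assms bspec[OF T(2) that]] .
    have "\<forall>u\<in>T. bnd R i (f u) = 0"
      using K.coeff_module_direct_sum[of "V (i - 1)", OF V_subspace] unfolding is_direct_sum_def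
      by (elim conjE allE[of _ T] allE[of _ "\<lambda>u. bnd R i (f u)"] mp) (use sum part T(1) in simp)
    then have bnd_f: "bnd R i (f u) = 0" if "u \<in> T" for u
      using that by blast
    have "f u \<in> boundaries R i" if "u \<in> T" for u
    proof (cases "divisors u = {}")
      case True
      \<comment> \<open>If no element of Q divides u, the strand is zero in every degree i \<ge>
        1.\<close>
      have "coeff_sum (f u) \<in> chn (ideal_subcomplex X {}) (i - 1)"
        using coeff_sum_in_ideal_subcomplex[OF _ bspec[OF T(2) that]] assms True by simp
      then have "coeff_sum (f u) = 0"
        using assms by (simp add: ideal_subcomplex_def family_sum_def)
      then have "f u = 0"
        by (rule coeff_sum_eq_zero[OF bspec[OF T(2) that]])
      then show ?thesis
        by (simp add: zero_in_boundaries)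
    next
      case False
      then show ?thesis
        unfolding boundaries_R using assms bspec[OF T(2) that] bnd_f[OF that]
        by (intro multidegree_exact) auto
    qed
    then show "h \<in> boundaries R i"
      unfolding T(3) by (rule boundaries_sum)
  qed
qed

section \<open>Minimality and the augmentation\<close>

lemma bnd_R_in_max_ideal_span:
  assumes "1 \<le> i" and "h \<in> coeff_module (V i)"
  shows "bnd R i h \<in> F.span {poly_smul (smul X) p g | p g. p \<in> max_ideal \<and> g \<in> coeff_module (V (i - 1))}"
    (is "_ \<in> F.span ?S")
  using assms(2)
proof (induction h rule: F_induct)
  case zero
  show ?case
    by (simp add: bnd_R_zero F.span_zero)
next
  case (add f g)
  then show ?case
    by (simp add: bnd_R_add F.span_add)
next
  case (single m a v)
  obtain M z where M: "\<And>m'. m' \<in> M \<Longrightarrow> z m' \<in> V (i - 1) m' \<and> mono_dvd m' m \<and> m' \<noteq> m"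
    "\<And>a. bnd R i (Poly_Mapping.single (m, a) v)
      = (\<Sum>m'\<in>M. Poly_Mapping.single (m', a + (m - m')) (z m'))"
    by (rule bnd_single[OF assms(1) single]) blast
  have "Poly_Mapping.single (m', a + (m - m')) (z m') \<in> F.span ?S" if "m' \<in> M" for m'
  proof (rule F.span_base)
    \<comment> \<open>As m' divides m, a zero difference would give m' = m, which strictness
      excludes.\<close>
    have "m - m' \<noteq> 0"
      using M(1)[OF that] mono_dvd_add_diff[of m' m] by auto
    then have "a + (m - m') \<noteq> 0"
      by (auto simp: poly_mapping_eq_iff fun_eq_iff lookup_add)
    then have "(mono_poly (a + (m - m')) :: ('n, 'k) mpoly) \<in> max_ideal"
      by (rule mono_poly_in_max_ideal)
    moreover have "Poly_Mapping.single (m', 0) (z m') \<in> coeff_module (V (i - 1))"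
      using M(1)[OF that] by (simp add: single_in_F)
    moreover have "Poly_Mapping.single (m', a + (m - m')) (z m')
        = poly_smul (smul X) (mono_poly (a + (m - m'))) (Poly_Mapping.single (m', 0) (z m'))"
      by (simp add: mono_poly_def K.poly_smul_single_single)
    ultimately show "Poly_Mapping.single (m', a + (m - m')) (z m') \<in> ?S"
      by blast
  qed
  then show ?case
    unfolding M(2) by (rule F.span_sum)
qed

text \<open>A nonzero vector \<open>\<zeta>\<close> in degree -1 gives an isomorphism
  \<open>\<tau>\<close> from S to F_0 with \<open>\<tau> p\<close> = p(\<open>\<zeta>\<close>
  \<otimes> 1). The augmentation is its inverse followed by the projection to S/I, so the kernel is
  \<open>\<tau>\<close> applied to I; the core is that this equals the image of the
  differential.\<close>

lemma augmentation_exact: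
  fixes I :: "('n, 'k) mpoly set"
  assumes I: "I = {p. \<forall>a\<in>Poly_Mapping.keys p. \<exists>m\<in>Q. mono_dvd m a}"
  shows "\<exists>\<epsilon>. is_augmentation I R \<epsilon> \<and> {g \<in> chn R 0. \<epsilon> g = I} = boundaries R 0"
proof -
  have I_iff: "p \<in> I \<longleftrightarrow> (\<forall>a\<in>Poly_Mapping.keys p. divisors a \<noteq> {})" for p
    unfolding I divisors_def by blast
  interpret S: module "(*) :: ('n, 'k) mpoly \<Rightarrow> _"
    by (rule module_on_ring)
  have "I = S.span (mono_poly ` Q)"
    using ideal_gen_mono_poly[of Q, where 'k = 'k] by (simp add: I ideal_gen_def)
  then have subspace_I: "S.subspace I"
    by simp
  have coset_iff: "coset I p = coset I q \<longleftrightarrow> p - q \<in> I" for p q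
    by (rule coset_eq_iff) (auto intro: S.subspace_0[OF subspace_I] S.subspace_diff[OF subspace_I])
  obtain B where B: "B \<subseteq> chn X (-1)" "K.independent B" "chn X (-1) \<subseteq> K.span B" "card B = 1"
    by (rule K.basis_exists[of "chn X (-1)"]) (simp add: dim_chn_minus_one)
  then obtain \<zeta> where \<zeta>: "B = {\<zeta>}"
    by (auto simp: card_1_singleton_iff)
  have \<zeta>_nz: "\<zeta> \<noteq> 0"
    using B(2) K.dependent_zero[of B] \<zeta> by auto
  have \<zeta>_in: "\<zeta> \<in> V 0 0"
    using B(1) \<zeta> by (simp add: V_minus_one)
  define \<tau> where "\<tau> p = poly_smul (smul X) p (Poly_Mapping.single (0, 0) \<zeta>)" for p :: "('n, 'k) mpoly"
  have \<tau>_single: "\<tau> (Poly_Mapping.single a c) = Poly_Mapping.single (0, a) (smul X c \<zeta>)" for a c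
    by (simp add: \<tau>_def K.poly_smul_single_single)
  have \<tau>_add: "\<tau> (p + q) = \<tau> p + \<tau> q" for p q
    by (simp add: \<tau>_def K.poly_smul_add_left)
  have \<tau>_smul: "\<tau> (r * p) = poly_smul (smul X) r (\<tau> p)" for r p
    unfolding \<tau>_def by (rule K.poly_smul_assoc)
  have lookup_\<tau>: "Poly_Mapping.lookup (\<tau> p) (0, a) = smul X (Poly_Mapping.lookup p a) \<zeta>" for p a
    by (simp add: \<tau>_def K.lookup_poly_smul_single_right)
  have \<tau>_zero: "\<tau> 0 = 0"
    by (simp add: \<tau>_def K.poly_smul_zero_left)
  have inj: "inj \<tau>"
  proof (rule injI, rule poly_mapping_eqI)
    fix p q a
    assume "\<tau> p = \<tau> q"
    then have "smul X (Poly_Mapping.lookup p a) \<zeta> = smul X (Poly_Mapping.lookup q a) \<zeta>"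
      by (simp flip: lookup_\<tau>)
    then show "Poly_Mapping.lookup p a = Poly_Mapping.lookup q a"
      using \<zeta>_nz by (simp add: K.scale_cancel_right)
  qed
  have range: "range \<tau> = coeff_module (V 0)"
  proof
    show "range \<tau> \<subseteq> coeff_module (V 0)"
      unfolding \<tau>_def using K.poly_smul_in_coeff_module[of "V 0", OF V_subspace single_in_F[OF \<zeta>_in]] by blast
  next
    show "coeff_module (V 0) \<subseteq> range \<tau>"
    proof
      fix h
      assume "h \<in> coeff_module (V 0)"
      then show "h \<in> range \<tau>"
      proof (induction h rule: F_induct)
        case zero
        show ?case
          using \<tau>_zero by (metis rangeI)
      next
        case (add f g)
        then obtain p q where "f = \<tau> p" "g = \<tau> q"
          by blast
        then have "f + g = \<tau> (p + q)"
          by (simp add: \<tau>_add)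
        then show ?case
          by blast
      next
        case (single m a v)
        show ?case
        proof (cases "m = 0")
          case True
          then have "v \<in> K.span {\<zeta>}"
            using single B(3) \<zeta> by (auto simp: V_minus_one)
          then obtain c where "v = smul X c \<zeta>"
            by (auto simp: K.span_singleton)
          with True have "Poly_Mapping.single (m, a) v = \<tau> (Poly_Mapping.single a c)"
            by (simp add: \<tau>_single)
          then show ?thesis
            by blast
        next
          case False
          with single have "v = 0"
            by (simp add: synor_coeffs_def)
          then have "Poly_Mapping.single (m, a) v = \<tau> 0"
            by (simp add: \<tau>_zero)
          then show ?thesis
            by blast
        qed
      qed
    qed
  qed
  \<comment> \<open>A monomial x^a in I maps to a cycle, since F_(-1) = 0, and its strand is exact.
    Conversely, a homogeneous element with index m in Q has a boundary of multidegree m + a, which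
    is the image of a multiple of the monomial x^(m + a) of I.\<close>
  have image_I: "\<tau> ` I = boundaries R 0"
  proof
    show "\<tau> ` I \<subseteq> boundaries R 0"
    proof (rule image_subsetI)
      fix p
      assume p: "p \<in> I"
      show "\<tau> p \<in> boundaries R 0"
      proof (rule poly_mapping_sum_induct[where h = p])
        fix a
        assume "a \<in> Poly_Mapping.keys p"
        with p have "divisors a \<noteq> {}"
          by (simp add: I_iff)
        moreover have part: "\<tau> (Poly_Mapping.single a (Poly_Mapping.lookup p a)) \<in> multidegree_part (V 0) a"
          unfolding \<tau>_single by (rule single_in_part) (simp_all add: K.subspace_scale[OF V_subspace \<zeta>_in])
        moreover have "bnd R 0 (\<tau> (Poly_Mapping.single a (Poly_Mapping.lookup p a))) = 0"
          using bnd_R[OF multidegree_partD[OF part]] coeff_module_neg[of "-1"] by simp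
        ultimately show "\<tau> (Poly_Mapping.single a (Poly_Mapping.lookup p a)) \<in> boundaries R 0"
          unfolding boundaries_R by (intro multidegree_exact) auto
      qed (simp_all add: \<tau>_zero \<tau>_add zero_in_boundaries boundaries_add)
    qed
  next
    have "bnd R 1 h \<in> \<tau> ` I" if "h \<in> coeff_module (V 1)" for h
      using that
    proof (induction h rule: F_induct)
      case zero
      show ?case
        by (rule image_eqI[where x = 0]) (simp_all add: bnd_R_zero \<tau>_zero S.subspace_0[OF subspace_I])
    next
      case (add f g)
      then obtain p q where pq: "p \<in> I" "q \<in> I" "bnd R 1 f = \<tau> p" "bnd R 1 g = \<tau> q"
        by blast
      show ?case
        by (rule image_eqI[where x = "p + q"])
          (simp_all add: add.hyps bnd_R_add pq \<tau>_add S.subspace_add[OF subspace_I])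
    next
      case (single m a v)
      show ?case
      proof (cases "v = 0")
        case True
        show ?thesis
          by (rule image_eqI[where x = 0]) (simp_all add: True bnd_R_zero \<tau>_zero S.subspace_0[OF subspace_I])
      next
        case False
        have "m \<in> Q"
          using V_nonzero[OF single False] by simp
        then have div: "divisors (m + a) \<noteq> {}"
          by (auto simp: divisors_def mono_dvd_def)
        let ?h = "bnd R 1 (Poly_Mapping.single (m, a) v)"
        have part: "?h \<in> multidegree_part (V 0) (m + a)"
          using bnd_R_multidegree[of 1 "Poly_Mapping.single (m, a) v" "m + a"] single
          by (simp add: single_in_part)
        obtain p where p: "?h = \<tau> p"
          using multidegree_partD[OF part] range by blast
        \<comment> \<open>The multidegree of the key (0, b) is b, so homogeneity leaves p with at
          most one term.\<close>
        have "b = m + a" if "b \<in> Poly_Mapping.keys p" for b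
        proof -
          have "Poly_Mapping.lookup ?h (0, b) \<noteq> 0"
            using that \<zeta>_nz by (simp add: p lookup_\<tau> in_keys_iff)
          then have "(0, b) \<in> Poly_Mapping.keys ?h"
            by (simp add: in_keys_iff)
          with part show ?thesis
            by (auto simp: multidegree_part_def)
        qed
        then have "p \<in> I"
          using div by (auto simp: I_iff)
        with p show ?thesis
          by blast
      qed
    qed
    then show "boundaries R 0 \<subseteq> \<tau> ` I"
      by (auto simp: boundaries_R)
  qed
  define \<epsilon> where "\<epsilon> h = coset I (inv \<tau> h)" for h
  have \<epsilon>_\<tau>: "\<epsilon> (\<tau> p) = coset I p" for p
    by (simp add: \<epsilon>_def inv_f_f[OF inj])
  have coset_mem: "q \<in> coset I p \<longleftrightarrow> q - p \<in> I" for p q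
    by (auto simp: coset_def image_iff) (metis add_diff_cancel_left' diff_add_cancel add.commute)
  have "is_augmentation I R \<epsilon>"
    unfolding is_augmentation_def chn_R smul_R cmp_R
  proof (intro conjI ballI allI)
    show "\<epsilon> ` coeff_module (V 0) = {coset I f | f. True}"
      unfolding range[symmetric] by (auto simp: image_image \<epsilon>_\<tau>)
  next
    fix g h p q
    assume "g \<in> coeff_module (V 0)" "h \<in> coeff_module (V 0)" and pq: "p \<in> \<epsilon> g" "q \<in> \<epsilon> h"
    then obtain p' q' where gh: "g = \<tau> p'" "h = \<tau> q'"
      using range by blast
    have "(p - p') + (q - q') \<in> I"
      using pq unfolding gh \<epsilon>_\<tau> coset_mem by (rule S.subspace_add[OF subspace_I])
    then show "p + q \<in> \<epsilon> (g + h)"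
      unfolding gh \<tau>_add[symmetric] \<epsilon>_\<tau> coset_mem by (simp add: algebra_simps)
  next
    fix r g p
    assume "g \<in> coeff_module (V 0)" and p: "p \<in> \<epsilon> g"
    then obtain p' where g: "g = \<tau> p'"
      using range by blast
    have "r * (p - p') \<in> I"
      using p unfolding g \<epsilon>_\<tau> coset_mem by (rule S.subspace_scale[OF subspace_I])
    then show "r * p \<in> \<epsilon> (poly_smul (smul X) r g)"
      unfolding g \<tau>_smul[symmetric] \<epsilon>_\<tau> coset_mem by (simp add: algebra_simps)
  next
    fix u g
    assume g: "g \<in> multidegree_part (V 0) u"
    then obtain p where p: "g = \<tau> p"
      using multidegree_partD[OF g] range by blast
    have "Poly_Mapping.lookup p a = 0" if "a \<noteq> u" for a
    proof (rule ccontr)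
      assume "Poly_Mapping.lookup p a \<noteq> 0"
      then have "(0, a) \<in> Poly_Mapping.keys g"
        using \<zeta>_nz by (simp add: p lookup_\<tau> in_keys_iff)
      with g that show False
        by (auto simp: multidegree_part_def)
    qed
    then have "p = Poly_Mapping.single u (Poly_Mapping.lookup p u)"
      by (intro poly_mapping_eqI) (simp add: lookup_single when_def)
    then have "Poly_Mapping.single u (Poly_Mapping.lookup p u) \<in> \<epsilon> g"
      unfolding p \<epsilon>_\<tau> coset_mem by (simp add: S.subspace_0[OF subspace_I])
    then show "\<exists>c. Poly_Mapping.single u c \<in> \<epsilon> g" ..
  qed
  moreover have "{g \<in> chn R 0. \<epsilon> g = I} = boundaries R 0"
  proof -
    have "\<epsilon> (\<tau> p) = I \<longleftrightarrow> p \<in> I" for p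
      using coset_iff[of p 0] by (simp add: \<epsilon>_\<tau>) (simp add: coset_def)
    then have "{g \<in> range \<tau>. \<epsilon> g = I} = \<tau> ` I"
      by blast
    then show ?thesis
      by (simp add: chn_R range image_I)
  qed
  ultimately show ?thesis
    by blast
qed

lemma minimal_resolution:
  fixes I :: "('n, 'k) mpoly set"
  assumes "I = {p. \<forall>a\<in>Poly_Mapping.keys p. \<exists>m\<in>Q. mono_dvd m a}"
  shows "minimal_free_resolution I R"
  unfolding minimal_free_resolution_def free_resolution_def
proof (intro conjI allI impI)
  show "bnd R i ` chn R i
      \<subseteq> module.span (smul R) {smul R p g | p g. p \<in> max_ideal \<and> g \<in> chn R (i - 1)}" if "1 \<le> i" for i
    unfolding smul_R chn_R using that by (intro image_subsetI bnd_R_in_max_ideal_span)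
qed (simp_all add: multigraded_free exact augmentation_exact[OF assms])

end

text \<open>Properness of I is required by the construction: for the unit ideal the only minimal
  generator is 1, so Q is empty and F_* is S in degree 0, which resolves S and not S/I = 0.\<close>

theorem theorem6p3:
  fixes I :: "('n::finite, 'k::field) mpoly set"
    and R :: "(('n, 'k) mpoly, 'n mono \<times> 'n mono \<Rightarrow>\<^sub>0 'v::ab_group_add, 'n mono) gcplx"
  assumes "monomial_ideal I"
    and "I \<noteq> UNIV"
    and "synor_resolution I R"
  shows "minimal_free_resolution I R"
proof -
  obtain X \<phi> where "synor_complex (lcm_lattice I - {0}) mono_dvd X \<phi>"
    "synor_resolution_of (lcm_lattice I - {0}) X R"
    using assms(3) unfolding synor_resolution_def by blast
  then interpret synor_resolution_data "lcm_lattice I - {0}" X \<phi> R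
    by (rule synor_resolution_data.intro) (simp, rule lcm_lattice_top[OF assms(1,2)])
  show ?thesis
    by (rule minimal_resolution) (rule monomial_ideal_eq_lcm_multiples[OF assms(1,2)])
qed

end
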